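(* Let $n\ge 1$. The torsion subgroup of $\bar B_1(A_n(\mathbb{Z}))$ is given by an isomorphism of graded abelian groups $$\mathrm{tor}\,\bar B_1(A_n(\mathbb{Z}))\cong H^{ev,+}(\Omega(\mathbb{Z}^n))=\bigoplus_{k=1}^{\lfloor n/2\rfloor}H^{2k}(\Omega(\mathbb{Z}^n)).$$
   Context: $A_n(\mathbb{Z})$ is the free associative unital ring on $x_1,\dots,x_n$, $\mathbb{Z}_{\ge 0}^n$-graded by multidegree in the generators. For a ring $A$, $[a,b]=ab-ba$, $L_1(A)=A$, $L_{k+1}(A)=[A,L_k(A)]$ (the $\mathbb{Z}$-span of commutators), $M_k(A)=A\,L_k(A)$ (a two-sided ideal), and $\bar B_1(A)=A/(L_2(A)+M_3(A))$, which inherits the grading when $A=A_n(\mathbb{Z})$. $\Omega(\mathbb{Z}^n)=\bigoplus_{i=0}^n\Omega^i(\mathbb{Z}^n)$ is the algebra of polynomial differential forms in $x_1,\dots,x_n$ with integer coefficients: $\Omega^i(\mathbb{Z}^n)$ is the free $\mathbb{Z}[x_1,\dots,x_n]$-module on $dx_{j_1}\wedge\cdots\wedge dx_{j_i}$, $j_1<\dots<j_i$, with De Rham differential $d$. It is $\mathbb{Z}_{\ge 0}^n$-graded with $x_i$ and $dx_i$ both of multidegree $e_i$ ($d$ preserves multidegree). $H^i(\Omega(\mathbb{Z}^n))$ is the $i$-th cohomology group of $(\Omega(\mathbb{Z}^n),d)$. *)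

theory Defs
  imports
    "HOL-Library.Poly_Mapping"
    "HOL-Algebra.Ring"
    "HOL-Algebra.AbelCoset"
    "HOL-Algebra.Generated_Groups"
    "HOL-Algebra.Product_Groups"
begin

section \<open>The free associative ring\<close>

text \<open>
  Words are wrapped in a datatype so that they can be made an (additively written,
  noncommutative) monoid under concatenation.  The type \<open>'a word \<Rightarrow>\<^sub>0 int\<close> then carries the
  convolution product of \<^theory>\<open>HOL-Library.Poly_Mapping\<close>, that is, it is the integral monoid ring of
  the free monoid, which is the free associative unital ring.
\<close>

datatype 'a word = Word (letters: "'a list")

instantiation word :: (type) monoid_add
begin

definition zero_word :: "'a word" where
  "0 = Word []"

definition plus_word :: "'a word \<Rightarrow> 'a word \<Rightarrow> 'a word" where
  "u + v = Word (letters u @ letters v)"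

instance
  by standard (auto simp: zero_word_def plus_word_def)

end

text \<open>The generator \<open>x\<^sub>i\<close> (for \<open>1 \<le> i \<le> n\<close>) is \<open>Poly_Mapping.single (Word [i]) 1\<close>.\<close>

definition free_ring :: "nat \<Rightarrow> (nat word \<Rightarrow>\<^sub>0 int) ring" where
  "free_ring n =
     \<lparr>carrier = {p. \<forall>w \<in> Poly_Mapping.keys p. set (letters w) \<subseteq> {1..n}},
      monoid.mult = (*), one = 1, zero = 0, add = (+)\<rparr>"

lemma ring_free_ring: "ring (free_ring n)"
proof (rule ringI)
  show "abelian_group (free_ring n)"
  proof (rule abelian_groupI)
    fix p q assume "p \<in> carrier (free_ring n)" "q \<in> carrier (free_ring n)"
    then show "p \<oplus>\<^bsub>free_ring n\<^esub> q \<in> carrier (free_ring n)"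
      using Poly_Mapping.keys_add[of p q] by (auto simp: free_ring_def)
  next
    fix p assume p: "p \<in> carrier (free_ring n)"
    then show "\<exists>q\<in>carrier (free_ring n). q \<oplus>\<^bsub>free_ring n\<^esub> p = \<zero>\<^bsub>free_ring n\<^esub>"
      by (intro bexI[of _ "- p"]) (auto simp: free_ring_def)
  qed (auto simp: free_ring_def algebra_simps)
  show "Group.monoid (free_ring n)"
  proof (rule monoidI)
    fix p q assume "p \<in> carrier (free_ring n)" "q \<in> carrier (free_ring n)"
    then show "p \<otimes>\<^bsub>free_ring n\<^esub> q \<in> carrier (free_ring n)"
      using keys_mult[of p q] by (fastforce simp: free_ring_def plus_word_def)
  next
    show "\<one>\<^bsub>free_ring n\<^esub> \<in> carrier (free_ring n)"
      by (auto simp: free_ring_def zero_word_def simp flip: single_one)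
  qed (auto simp: free_ring_def mult.assoc)
qed (auto simp: free_ring_def distrib_left distrib_right)

text \<open>
  Multidegrees are finitely supported functions on the indices of the variables; those of
  objects in the variables \<open>x\<^sub>1, \<dots>, x\<^sub>n\<close> lie in \<open>multidegrees n\<close>, which is the set of
  \<open>n\<close>-tuples of natural numbers.
\<close>

definition multidegrees :: "nat \<Rightarrow> (nat \<Rightarrow>\<^sub>0 nat) set" where
  "multidegrees n = {m. Poly_Mapping.keys m \<subseteq> {1..n}}"

definition word_mdeg :: "nat word \<Rightarrow> (nat \<Rightarrow>\<^sub>0 nat)" where
  "word_mdeg w = (\<Sum>i\<leftarrow>letters w. Poly_Mapping.single i 1)"

definition free_ring_component :: "nat \<Rightarrow> (nat \<Rightarrow>\<^sub>0 nat) \<Rightarrow> (nat word \<Rightarrow>\<^sub>0 int) set" where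
  "free_ring_component n m =
     {p \<in> carrier (free_ring n). \<forall>w \<in> Poly_Mapping.keys p. word_mdeg w = m}"


section \<open>The lower central series\<close>

text \<open>The series is indexed from 1; the value of \<open>lcs\<close> at index 0 is irrelevant.\<close>

fun lcs :: "('a, 'b) ring_scheme \<Rightarrow> nat \<Rightarrow> 'a set" where
  "lcs R 0 = carrier R"
| "lcs R (Suc 0) = carrier R"
| "lcs R (Suc (Suc k)) =
     generate (add_monoid R)
       {(a \<otimes>\<^bsub>R\<^esub> b) \<ominus>\<^bsub>R\<^esub> (b \<otimes>\<^bsub>R\<^esub> a) | a b. a \<in> carrier R \<and> b \<in> lcs R (Suc k)}"

definition lcs_ideal :: "('a, 'b) ring_scheme \<Rightarrow> nat \<Rightarrow> 'a set" where
  "lcs_ideal R k = generate (add_monoid R) {a \<otimes>\<^bsub>R\<^esub> b | a b. a \<in> carrier R \<and> b \<in> lcs R k}"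

definition B1bar_kernel :: "('a, 'b) ring_scheme \<Rightarrow> 'a set" where
  "B1bar_kernel R = lcs R 2 <+>\<^bsub>R\<^esub> lcs_ideal R 3"

definition B1bar :: "('a, 'b) ring_scheme \<Rightarrow> 'a set monoid" where
  "B1bar R = add_monoid R Mod B1bar_kernel R"

definition B1bar_component :: "nat \<Rightarrow> (nat \<Rightarrow>\<^sub>0 nat) \<Rightarrow> (nat word \<Rightarrow>\<^sub>0 int) set set" where
  "B1bar_component n m =
     (\<lambda>p. B1bar_kernel (free_ring n) +>\<^bsub>free_ring n\<^esub> p) ` free_ring_component n m"

definition torsion :: "('a, 'b) monoid_scheme \<Rightarrow> 'a set" where
  "torsion G = {x \<in> carrier G. \<exists>k::nat. k > 0 \<and> x [^]\<^bsub>G\<^esub> k = \<one>\<^bsub>G\<^esub>}"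

definition torsion_group :: "('a, 'b) monoid_scheme \<Rightarrow> ('a, 'b) monoid_scheme" where
  "torsion_group G = G\<lparr>carrier := torsion G\<rparr>"


section \<open>Integral polynomial differential forms\<close>

text \<open>
  A polynomial in commuting variables maps exponent vectors to coefficients.  A form
  \<open>\<Sum>\<^sub>J f\<^sub>J dx\<^sub>J\<close>, where \<open>dx\<^sub>J = dx\<^sub>j\<^sub>1 \<and> \<dots> \<and> dx\<^sub>j\<^sub>i\<close> for \<open>J = {j\<^sub>1 < \<dots> < j\<^sub>i}\<close>, maps \<open>J\<close> to \<open>f\<^sub>J\<close>.
\<close>

type_synonym ipoly = "(nat \<Rightarrow>\<^sub>0 nat) \<Rightarrow>\<^sub>0 int"
type_synonym form = "nat set \<Rightarrow>\<^sub>0 ipoly"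

definition forms :: "nat \<Rightarrow> nat \<Rightarrow> form set" where
  "forms n i =
     {\<omega>. \<forall>J \<in> Poly_Mapping.keys \<omega>. J \<subseteq> {1..n} \<and> card J = i \<and>
            (\<forall>a \<in> Poly_Mapping.keys (Poly_Mapping.lookup \<omega> J). Poly_Mapping.keys a \<subseteq> {1..n})}"

text \<open>
  In \<open>partial_deriv\<close>, the truncated subtraction in the exponent is harmless: it only occurs when the
  coefficient is 0.
\<close>

definition partial_deriv :: "nat \<Rightarrow> ipoly \<Rightarrow> ipoly" where
  "partial_deriv j f =
     (\<Sum>a \<in> Poly_Mapping.keys f.
        Poly_Mapping.single (a - Poly_Mapping.single j 1)
          (int (Poly_Mapping.lookup a j) * Poly_Mapping.lookup f a))"

text \<open>
  \<open>d (f dx\<^sub>J) = \<Sum>\<^sub>j (\<partial>\<^sub>j f) dx\<^sub>j \<and> dx\<^sub>J\<close>, where \<open>dx\<^sub>j \<and> dx\<^sub>J\<close> is 0 if \<open>j \<in> J\<close>, and otherwise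
  sorting the factors moves \<open>dx\<^sub>j\<close> past all \<open>dx\<^sub>l\<close> with \<open>l \<in> J\<close>, \<open>l < j\<close>.
\<close>

definition deRham :: "nat \<Rightarrow> form \<Rightarrow> form" where
  "deRham n \<omega> =
     (\<Sum>J \<in> Poly_Mapping.keys \<omega>. \<Sum>j \<in> {1..n} - J.
        Poly_Mapping.single (insert j J)
          ((-1) ^ card {l \<in> J. l < j} * partial_deriv j (Poly_Mapping.lookup \<omega> J)))"

definition closed_forms :: "nat \<Rightarrow> nat \<Rightarrow> form set" where
  "closed_forms n i = {\<omega> \<in> forms n i. deRham n \<omega> = 0}"

definition exact_forms :: "nat \<Rightarrow> nat \<Rightarrow> form set" where
  "exact_forms n i = (if i = 0 then {0} else deRham n ` forms n (i - 1))"

definition closed_forms_group :: "nat \<Rightarrow> nat \<Rightarrow> form monoid" where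
  "closed_forms_group n i = \<lparr>carrier = closed_forms n i, monoid.mult = (+), one = 0\<rparr>"

definition deRham_cohomology :: "nat \<Rightarrow> nat \<Rightarrow> form set monoid" where
  "deRham_cohomology n i = closed_forms_group n i Mod exact_forms n i"

definition form_component :: "(nat \<Rightarrow>\<^sub>0 nat) \<Rightarrow> form set" where
  "form_component m =
     {\<omega>. \<forall>J \<in> Poly_Mapping.keys \<omega>. \<forall>a \<in> Poly_Mapping.keys (Poly_Mapping.lookup \<omega> J).
            a + (\<Sum>j\<in>J. Poly_Mapping.single j 1) = m}"

definition cohomology_component :: "nat \<Rightarrow> nat \<Rightarrow> (nat \<Rightarrow>\<^sub>0 nat) \<Rightarrow> form set set" where
  "cohomology_component n i m =
     (\<lambda>\<omega>. exact_forms n i #>\<^bsub>closed_forms_group n i\<^esub> \<omega>) ` (closed_forms n i \<inter> form_component m)"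

definition H_ev_plus :: "nat \<Rightarrow> (nat \<Rightarrow> form set) monoid" where
  "H_ev_plus n = sum_group {1..n div 2} (\<lambda>k. deRham_cohomology n (2 * k))"

definition H_ev_plus_component :: "nat \<Rightarrow> (nat \<Rightarrow>\<^sub>0 nat) \<Rightarrow> (nat \<Rightarrow> form set) set" where
  "H_ev_plus_component n m =
     {h \<in> carrier (H_ev_plus n). \<forall>k\<in>{1..n div 2}. h k \<in> cohomology_component n (2 * k) m}"

end

theory Submission
  imports Defs "HOL.Modules" "HOL-Library.Multiset"
begin

text \<open>
  Write \<open>A\<close> for the free ring and \<open>\<Omega>\<close> for the integral polynomial forms.  Modulo \<open>M\<^sub>3\<close> the
  commutators \<open>[x\<^sub>i, x\<^sub>j]\<close> are central and satisfy \<open>[a, b] [c, d] = - [a, c] [b, d]\<close>, so for \<open>i < j\<close> they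
  behave like the two-forms \<open>dx\<^sub>i \<and> dx\<^sub>j\<close>, and \<open>A / M\<^sub>3\<close> turns out to be isomorphic to the even forms.  Over the
  rationals this is a ring isomorphism for the product \<open>a b + 1/2 da \<and> db\<close>.  The
  denominators disappear when the variables are put in normal order: if all \<open>x\<^sub>i\<close> are moved to the left
  of all \<open>x\<^sub>j\<close> with \<open>i < j\<close>, the product of two even forms becomes the result of applying
  \<open>\<Prod>\<^sub>j\<^sub><\<^sub>i (1 + dx\<^sub>i \<and> dx\<^sub>j \<and> (\<partial>\<^sub>i \<otimes> \<partial>\<^sub>j))\<close> before multiplying, which is integral.

  Only the products with a variable matter.  Left and right multiplication by \<open>x\<^sub>i\<close> become
  \<open>X\<^sub>i = x\<^sub>i + \<Sum>\<^sub>j\<^sub><\<^sub>i dx\<^sub>i \<and> dx\<^sub>j \<and> \<partial>\<^sub>j\<close> (\<open>left_mul\<close>) and \<open>R\<^sub>i = x\<^sub>i - \<Sum>\<^sub>j\<^sub>>\<^sub>i dx\<^sub>i \<and> dx\<^sub>j \<and> \<partial>\<^sub>j\<close>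
  (\<open>right_mul\<close>).  All \<open>X\<^sub>i\<close> commute with all \<open>R\<^sub>j\<close>, so letting words act on the form 1 through the \<open>X\<^sub>i\<close>
  gives an additive map \<open>to_form\<close> that turns left and right multiplication by \<open>x\<^sub>i\<close> into \<open>X\<^sub>i\<close> and
  \<open>R\<^sub>i\<close>.  Since \<open>X\<^sub>i - R\<^sub>i = dx\<^sub>i \<and> d\<close>, it sends \<open>[x\<^sub>i, p]\<close> to \<open>dx\<^sub>i \<and> d (to_form p)\<close>.

  As \<open>L\<^sub>2\<close> is spanned by the \<open>[x\<^sub>i, p]\<close>, and the odd forms by the \<open>dx\<^sub>i \<and> \<omega>\<close> with \<open>\<omega>\<close> even, the image of
  \<open>L\<^sub>2\<close> is the group of exact even forms of positive degree (\<open>to_form_L2\<close>, \<open>odd_form_exact_in_image\<close>).  These are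
  closed, so \<open>L\<^sub>3\<close>, and with it \<open>M\<^sub>3\<close>, is mapped to 0.  Conversely \<open>from_form\<close> sends \<open>x\<^sup>a dx\<^sub>J\<close> to the
  ordered monomial \<open>x\<^sup>a\<close> times \<open>[x\<^sub>j\<^sub>1, x\<^sub>j\<^sub>2] [x\<^sub>j\<^sub>3, x\<^sub>j\<^sub>4] \<dots>\<close>; it is a right inverse of \<open>to_form\<close>, and
  reordering letters shows that it is a left inverse modulo \<open>M\<^sub>3\<close> (\<open>to_form_from_form\<close>,
  \<open>from_form_to_form\<close>).  Hence \<open>A / (L\<^sub>2 + M\<^sub>3)\<close> is the quotient of the even forms by the exact ones
  (\<open>ker_iff\<close>), and all maps preserve multidegrees.

  It remains to find the torsion of that quotient.  If a positive multiple of \<open>\<omega>\<close> is exact, then \<open>\<omega>\<close> is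
  closed without component in degree 0, because forms have no torsion.  Conversely, contraction with the
  Euler field gives a homotopy \<open>d \<iota> + \<iota> d\<close> that multiplies a form of total degree \<open>N\<close> by \<open>N\<close>, so a suitable
  multiple of such an \<open>\<omega>\<close> is exact (\<open>closed_multiple_exact\<close>).  Splitting \<open>\<omega>\<close> by degree yields the
  cohomology groups of positive even degree.
\<close>


section \<open>Additive maps on finitely supported functions\<close>

text \<open>
  The coefficient is passed to \<open>g\<close>, so that any abelian group can serve as the target and extensions
  can be nested: the coefficients of a form are polynomials, which are again finitely supported.
\<close>

definition linext :: "('k \<Rightarrow> 'v \<Rightarrow> 'b) \<Rightarrow> ('k \<Rightarrow>\<^sub>0 'v::ab_group_add) \<Rightarrow> 'b::ab_group_add" where
  "linext g f = (\<Sum>k \<in> Poly_Mapping.keys f. g k (Poly_Mapping.lookup f k))"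

lemma linext_single:
  assumes "g k 0 = 0"
  shows "linext g (Poly_Mapping.single k v) = g k v"
  using assms by (simp add: linext_def)

lemma additive_linext:
  assumes "\<And>k. additive (g k)"
  shows "additive (linext g)"
proof
  fix f f' :: "'a \<Rightarrow>\<^sub>0 'b"
  let ?K = "Poly_Mapping.keys f \<union> Poly_Mapping.keys f'"
  have eq: "linext g h = (\<Sum>k\<in>?K. g k (Poly_Mapping.lookup h k))" if "Poly_Mapping.keys h \<subseteq> ?K" for h
    unfolding linext_def using that
    by (intro sum.mono_neutral_left) (auto simp: in_keys_iff additive.zero[OF assms])
  have "Poly_Mapping.keys (f + f') \<subseteq> ?K"
    by (rule keys_add)
  then show "linext g (f + f') = linext g f + linext g f'"
    by (simp add: eq lookup_add additive.add[OF assms] sum.distrib)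
qed

lemma poly_mapping_as_sum:
  fixes f :: "'k \<Rightarrow>\<^sub>0 'v::ab_group_add"
  shows "f = (\<Sum>k \<in> Poly_Mapping.keys f. Poly_Mapping.single k (Poly_Mapping.lookup f k))"
  by (rule poly_mapping_eqI) (auto simp: lookup_sum lookup_single when_def in_keys_iff)

lemma poly_mapping_span_induct [case_names zero add single]:
  fixes f :: "'k \<Rightarrow>\<^sub>0 'v::ab_group_add"
  assumes "Q 0" and add: "\<And>f f'. Q f \<Longrightarrow> Q f' \<Longrightarrow> Q (f + f')"
    and "\<And>k. k \<in> Poly_Mapping.keys f \<Longrightarrow> Q (Poly_Mapping.single k (Poly_Mapping.lookup f k))"
  shows "Q f"
proof -
  have partial_sum: "Q (\<Sum>k\<in>K. Poly_Mapping.single k (Poly_Mapping.lookup f k))"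
    if "finite K" "K \<subseteq> Poly_Mapping.keys f" for K
    using that
  proof (induction K rule: finite_induct)
    case (insert k K)
    then show ?case by (simp add: add assms(3))
  qed (simp add: assms(1))
  show ?thesis
    by (rule ssubst[OF poly_mapping_as_sum, where P = Q], rule partial_sum) simp_all
qed

lemma additive_minus_fun: "additive f \<Longrightarrow> additive g \<Longrightarrow> additive (\<lambda>x. f x - g x)"
  by (simp add: additive_def algebra_simps)

lemma additive_plus_fun: "additive f \<Longrightarrow> additive g \<Longrightarrow> additive (\<lambda>x. f x + g x)"
  by (simp add: additive_def algebra_simps)

lemma additive_uminus_fun: "additive f \<Longrightarrow> additive (\<lambda>x. - f x)"
  by (simp add: additive_def algebra_simps)

lemma additive_comp: "additive f \<Longrightarrow> additive g \<Longrightarrow> additive (\<lambda>x. f (g x))"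
  by (simp add: additive_def)

lemma additive_sum_fun: "(\<And>i. i \<in> I \<Longrightarrow> additive (f i)) \<Longrightarrow> additive (\<lambda>x. \<Sum>i\<in>I. f i x)"
  by (simp add: additive_def sum.distrib)

lemma additive_id: "additive (\<lambda>x. x)" and additive_zero: "additive (\<lambda>x. 0)"
  by (simp_all add: additive_def)

lemmas additive_intros = additive_minus_fun additive_plus_fun additive_uminus_fun additive_sum_fun
  additive_id additive_zero

lemma additive_scaled_single: "additive (\<lambda>c::int. Poly_Mapping.single k (r * c))"
  by (simp add: additive_def single_add distrib_left)


section \<open>Differential forms and operators on them\<close>

definition mono_form :: "nat set \<Rightarrow> (nat \<Rightarrow>\<^sub>0 nat) \<Rightarrow> int \<Rightarrow> form" where
  "mono_form J a c = Poly_Mapping.single J (Poly_Mapping.single a c)"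

abbreviation coeff :: "form \<Rightarrow> nat set \<Rightarrow> (nat \<Rightarrow>\<^sub>0 nat) \<Rightarrow> int" where
  "coeff \<omega> J a \<equiv> Poly_Mapping.lookup (Poly_Mapping.lookup \<omega> J) a"

definition form_ext :: "(nat set \<Rightarrow> (nat \<Rightarrow>\<^sub>0 nat) \<Rightarrow> int \<Rightarrow> 'b) \<Rightarrow> form \<Rightarrow> 'b::ab_group_add" where
  "form_ext g = linext (\<lambda>J. linext (g J))"

lemma additive_form_ext:
  assumes "\<And>J a. additive (g J a)"
  shows "additive (form_ext g)"
  unfolding form_ext_def using assms by (intro additive_linext)

lemma form_ext_mono:
  assumes "\<And>J a. additive (g J a)"
  shows "form_ext g (mono_form J a c) = g J a c"
proof -
  have "linext (g J) 0 = 0" by (simp add: linext_def)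
  then show ?thesis
    unfolding form_ext_def mono_form_def using additive.zero[OF assms]
    by (simp add: linext_single)
qed

lemma additive_mono_form: "additive (mono_form J a)"
  by (simp add: additive_def mono_form_def single_add)

lemma mono_form_zero [simp]: "mono_form J a 0 = 0"
  by (simp add: mono_form_def)

lemma mono_form_add: "mono_form J a (c + c') = mono_form J a c + mono_form J a c'"
  by (rule additive.add[OF additive_mono_form])

lemma mono_form_uminus: "mono_form J a (- c) = - mono_form J a c"
  by (rule additive.minus[OF additive_mono_form])

lemma additive_mono_form_times: "additive (\<lambda>c. mono_form J a (r * c))"
  by (simp add: additive_def mono_form_add distrib_left)

lemma coeff_mono_form: "coeff (mono_form J a c) J' a' = (if J = J' \<and> a = a' then c else 0)"
  by (auto simp: mono_form_def lookup_single when_def)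

definition supported :: "(nat set \<Rightarrow> (nat \<Rightarrow>\<^sub>0 nat) \<Rightarrow> bool) \<Rightarrow> form \<Rightarrow> bool" where
  "supported P \<omega> \<longleftrightarrow> (\<forall>J a. coeff \<omega> J a \<noteq> 0 \<longrightarrow> P J a)"

lemma supported_induct [consumes 1, case_names zero add mono]:
  assumes P: "supported P \<omega>" and zero: "Q 0" and add: "\<And>\<omega> \<eta>. Q \<omega> \<Longrightarrow> Q \<eta> \<Longrightarrow> Q (\<omega> + \<eta>)"
    and mono: "\<And>J a c. P J a \<Longrightarrow> Q (mono_form J a c)"
  shows "Q \<omega>"
proof (induction \<omega> rule: poly_mapping_span_induct)
  case (single J)
  define f where "f = Poly_Mapping.lookup \<omega> J"
  have PJ: "P J a" if "a \<in> Poly_Mapping.keys f" for a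
    using that P by (auto simp: supported_def in_keys_iff f_def)
  have "Q (Poly_Mapping.single J f)"
  proof (induction f rule: poly_mapping_span_induct)
    case (add f f')
    then show ?case unfolding single_add by (rule assms(3))
  next
    case (single a)
    show ?case using mono[OF PJ[OF single]] by (simp only: mono_form_def)
  qed (simp only: single_zero zero)
  then show ?case by (simp only: f_def)
qed (fact zero, fact add)

lemma form_induct [case_names zero add mono]:
  assumes "Q 0" and "\<And>\<omega> \<eta>. Q \<omega> \<Longrightarrow> Q \<eta> \<Longrightarrow> Q (\<omega> + \<eta>)" and "\<And>J a c. Q (mono_form J a c)"
  shows "Q \<omega>"
proof -
  have "supported (\<lambda>_ _. True) \<omega>" by (simp add: supported_def)
  then show ?thesis by (induction rule: supported_induct) (simp_all only: assms)
qed

lemma additive_form_eqI: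
  assumes "additive f" "additive g" "\<And>J a c. f (mono_form J a c) = g (mono_form J a c)"
  shows "f \<omega> = g \<omega>"
  by (induction \<omega> rule: form_induct)
    (simp_all add: additive.add[OF assms(1)] additive.add[OF assms(2)]
      additive.zero[OF assms(1)] additive.zero[OF assms(2)] assms(3))

lemma supported_zero [simp]: "supported P 0"
  by (simp add: supported_def)

lemma supported_add: "supported P \<omega> \<Longrightarrow> supported P \<eta> \<Longrightarrow> supported P (\<omega> + \<eta>)"
  unfolding supported_def
proof (intro allI impI)
  fix J a
  assume P: "\<forall>J a. coeff \<omega> J a \<noteq> 0 \<longrightarrow> P J a" "\<forall>J a. coeff \<eta> J a \<noteq> 0 \<longrightarrow> P J a"
    and "coeff (\<omega> + \<eta>) J a \<noteq> 0"
  then have "coeff \<omega> J a \<noteq> 0 \<or> coeff \<eta> J a \<noteq> 0"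
    by (auto simp: lookup_add)
  then show "P J a" using P by blast
qed

lemma supported_uminus: "supported P \<omega> \<Longrightarrow> supported P (- \<omega>)"
  by (auto simp: supported_def)

lemma supported_diff: "supported P \<omega> \<Longrightarrow> supported P \<eta> \<Longrightarrow> supported P (\<omega> - \<eta>)"
  using supported_add[of P \<omega> "- \<eta>"] supported_uminus[of P \<eta>] by simp

lemma supported_sum: "(\<And>i. i \<in> I \<Longrightarrow> supported P (f i)) \<Longrightarrow> supported P (\<Sum>i\<in>I. f i)"
  by (induction I rule: infinite_finite_induct) (auto intro: supported_add)

lemma supported_mono_form: "P J a \<Longrightarrow> supported P (mono_form J a c)"
  by (auto simp: supported_def coeff_mono_form)

lemma supported_weaken: "supported P \<omega> \<Longrightarrow> (\<And>J a. P J a \<Longrightarrow> P' J a) \<Longrightarrow> supported P' \<omega>"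
  by (auto simp: supported_def)

definition dx_sign :: "nat \<Rightarrow> nat set \<Rightarrow> int" where
  "dx_sign i J = (-1) ^ card {l \<in> J. l < i}"

definition wedge :: "nat \<Rightarrow> form \<Rightarrow> form" where
  "wedge i = form_ext (\<lambda>J a c. if i \<in> J then 0 else mono_form (insert i J) a (dx_sign i J * c))"

definition contract :: "nat \<Rightarrow> form \<Rightarrow> form" where
  "contract i = form_ext (\<lambda>J a c. if i \<in> J then mono_form (J - {i}) a (dx_sign i J * c) else 0)"

definition xmul :: "nat \<Rightarrow> form \<Rightarrow> form" where
  "xmul i = form_ext (\<lambda>J a c. mono_form J (a + Poly_Mapping.single i 1) c)"

definition pderiv_form :: "nat \<Rightarrow> form \<Rightarrow> form" where
  "pderiv_form i = form_ext (\<lambda>J a c. mono_form J (a - Poly_Mapping.single i 1) (int (Poly_Mapping.lookup a i) * c))"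

text \<open>
  The projections to a degree, multiplication by an integer and division by the weight in the
  Euler homotopy are all of this diagonal kind.
\<close>

definition reweight :: "(nat set \<Rightarrow> (nat \<Rightarrow>\<^sub>0 nat) \<Rightarrow> int) \<Rightarrow> form \<Rightarrow> form" where
  "reweight g = form_ext (\<lambda>J a c. mono_form J a (g J a * c))"

lemma additive_if: "additive f \<Longrightarrow> additive g \<Longrightarrow> additive (\<lambda>x. if b then f x else g x)"
  by (cases b) auto

lemmas basis_additive = additive_if additive_mono_form additive_mono_form_times additive_zero

lemma additive_wedge: "additive (wedge i)"
  and additive_contract: "additive (contract i)"
  and additive_xmul: "additive (xmul i)"
  and additive_pderiv_form: "additive (pderiv_form i)"
  and additive_reweight: "additive (reweight g)"
  unfolding wedge_def contract_def xmul_def pderiv_form_def reweight_def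
  by (intro additive_form_ext basis_additive)+

lemma wedge_mono:
    "wedge i (mono_form J a c) = (if i \<in> J then 0 else mono_form (insert i J) a (dx_sign i J * c))"
  and contract_mono:
    "contract i (mono_form J a c) = (if i \<in> J then mono_form (J - {i}) a (dx_sign i J * c) else 0)"
  and xmul_mono: "xmul i (mono_form J a c) = mono_form J (a + Poly_Mapping.single i 1) c"
  and pderiv_form_mono: "pderiv_form i (mono_form J a c) =
      mono_form J (a - Poly_Mapping.single i 1) (int (Poly_Mapping.lookup a i) * c)"
  and reweight_mono: "reweight g (mono_form J a c) = mono_form J a (g J a * c)"
  unfolding wedge_def contract_def xmul_def pderiv_form_def reweight_def
  by (subst form_ext_mono; (intro basis_additive)?; simp)+

lemmas op_mono = wedge_mono contract_mono xmul_mono pderiv_form_mono reweight_mono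

lemmas op_additive = additive_wedge additive_contract additive_xmul additive_pderiv_form additive_reweight

lemmas op_additive_comp = op_additive[THEN additive_comp]

lemmas wedge_add [simp] = additive.add[OF additive_wedge]
lemmas wedge_zero [simp] = additive.zero[OF additive_wedge]
lemmas wedge_minus [simp] = additive.minus[OF additive_wedge]
lemmas wedge_sum = additive.sum[OF additive_wedge]
lemmas contract_add [simp] = additive.add[OF additive_contract]
lemmas contract_zero [simp] = additive.zero[OF additive_contract]
lemmas contract_sum = additive.sum[OF additive_contract]
lemmas xmul_add [simp] = additive.add[OF additive_xmul]
lemmas xmul_zero [simp] = additive.zero[OF additive_xmul]
lemmas xmul_diff [simp] = additive.diff[OF additive_xmul]
lemmas xmul_sum = additive.sum[OF additive_xmul]
lemmas pderiv_form_add [simp] = additive.add[OF additive_pderiv_form]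
lemmas pderiv_form_zero [simp] = additive.zero[OF additive_pderiv_form]
lemmas pderiv_form_sum = additive.sum[OF additive_pderiv_form]

lemma dx_sign_insert:
  assumes "j \<notin> J"
  shows "dx_sign i (insert j J) = (if j < i then - dx_sign i J else dx_sign i J)"
proof -
  have "{l \<in> insert j J. l < i} = (if j < i then insert j {l \<in> J. l < i} else {l \<in> J. l < i})"
    by auto
  moreover have "finite {l \<in> J. l < i}" by (rule finite_subset[of _ "{..<i}"]) auto
  ultimately show ?thesis using assms by (simp add: dx_sign_def)
qed

lemma dx_sign_remove:
  assumes "j \<in> J"
  shows "dx_sign i (J - {j}) = (if j < i then - dx_sign i J else dx_sign i J)"
  using dx_sign_insert[of j "J - {j}" i] assms by (simp add: insert_absorb split: if_splits)

lemma dx_sign_square [simp]: "dx_sign i J * dx_sign i J = 1" "dx_sign i J * (dx_sign i J * c) = c"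
  by (simp_all add: dx_sign_def flip: power_add mult.assoc mult_2)

lemma wedge_wedge: "wedge i (wedge j \<omega>) = - wedge j (wedge i \<omega>)"
  by (rule additive_form_eqI[of "\<lambda>\<omega>. wedge i (wedge j \<omega>)" "\<lambda>\<omega>. - wedge j (wedge i \<omega>)"],
      (intro additive_intros op_additive_comp op_additive)+)
    (auto simp: wedge_mono dx_sign_insert insert_commute mult.left_commute simp flip: mono_form_uminus)

lemma wedge_self [simp]: "wedge i (wedge i \<omega>) = 0"
  by (rule additive_form_eqI, (intro additive_intros op_additive_comp op_additive)+)
    (auto simp: wedge_mono)

text \<open>
  The Clifford relation between exterior multiplication and contraction.  Together with the
  relations below it makes every later identity between operators a formal computation.
\<close>

lemma contract_wedge:
  "contract i (wedge j \<omega>) = (if i = j then \<omega> else 0) - wedge j (contract i \<omega>)"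
proof (rule additive_form_eqI[of "\<lambda>\<omega>. contract i (wedge j \<omega>)" "\<lambda>\<omega>. (if i = j then \<omega> else 0) - wedge j (contract i \<omega>)"])
  fix J a c
  show "contract i (wedge j (mono_form J a c))
      = (if i = j then mono_form J a c else 0) - wedge j (contract i (mono_form J a c))"
    by (auto simp: wedge_mono contract_mono dx_sign_insert dx_sign_remove insert_Diff_if
        insert_absorb mult.left_commute simp flip: mono_form_uminus)
qed (intro additive_intros op_additive_comp op_additive additive_if)+

lemma xmul_wedge: "xmul i (wedge j \<omega>) = wedge j (xmul i \<omega>)"
  by (rule additive_form_eqI, (intro additive_intros op_additive_comp op_additive)+)
    (auto simp: op_mono)

lemma pderiv_wedge: "pderiv_form i (wedge j \<omega>) = wedge j (pderiv_form i \<omega>)"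
  by (rule additive_form_eqI, (intro additive_intros op_additive_comp op_additive)+)
    (auto simp: op_mono mult.left_commute)

lemma pderiv_contract: "pderiv_form i (contract j \<omega>) = contract j (pderiv_form i \<omega>)"
  by (rule additive_form_eqI, (intro additive_intros op_additive_comp op_additive)+)
    (auto simp: op_mono mult.left_commute)

lemma xmul_xmul: "xmul i (xmul j \<omega>) = xmul j (xmul i \<omega>)"
  by (rule additive_form_eqI, (intro additive_intros op_additive_comp op_additive)+)
    (auto simp: op_mono add_ac)

lemma pderiv_pderiv: "pderiv_form i (pderiv_form j \<omega>) = pderiv_form j (pderiv_form i \<omega>)"
proof (rule additive_form_eqI[of "\<lambda>\<omega>. pderiv_form i (pderiv_form j \<omega>)" "\<lambda>\<omega>. pderiv_form j (pderiv_form i \<omega>)"])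
  fix J a c
  have "a - Poly_Mapping.single j 1 - Poly_Mapping.single i 1
      = a - Poly_Mapping.single i 1 - Poly_Mapping.single j (1::nat)"
    by (rule poly_mapping_eqI) (auto simp: lookup_minus)
  then show "pderiv_form i (pderiv_form j (mono_form J a c)) = pderiv_form j (pderiv_form i (mono_form J a c))"
    by (auto simp: op_mono lookup_minus lookup_single when_def mult.left_commute)
qed (intro op_additive_comp op_additive)+

lemma pderiv_xmul:
  "pderiv_form i (xmul j \<omega>) = xmul j (pderiv_form i \<omega>) + (if i = j then \<omega> else 0)"
proof (rule additive_form_eqI[of "\<lambda>\<omega>. pderiv_form i (xmul j \<omega>)" "\<lambda>\<omega>. xmul j (pderiv_form i \<omega>) + (if i = j then \<omega> else 0)"])
  fix J a c
  have "a + Poly_Mapping.single j 1 - Poly_Mapping.single i 1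
      = a - Poly_Mapping.single i 1 + Poly_Mapping.single j (1::nat)"
    if "i \<noteq> j \<or> Poly_Mapping.lookup a i \<noteq> 0"
    using that by (intro poly_mapping_eqI) (auto simp: lookup_minus lookup_add lookup_single when_def)
  then show "pderiv_form i (xmul j (mono_form J a c))
      = xmul j (pderiv_form i (mono_form J a c)) + (if i = j then mono_form J a c else 0)"
    by (cases "i \<noteq> j \<or> Poly_Mapping.lookup a i \<noteq> 0")
      (auto simp: op_mono lookup_add lookup_single when_def distrib_right mono_form_add)
qed (intro additive_intros op_additive_comp op_additive additive_if)+

lemma partial_deriv_linext:
  "partial_deriv j = linext (\<lambda>a c. Poly_Mapping.single (a - Poly_Mapping.single j 1) (int (Poly_Mapping.lookup a j) * c))"
  by (simp add: fun_eq_iff partial_deriv_def linext_def)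

lemma additive_partial_deriv: "additive (partial_deriv j)"
  unfolding partial_deriv_linext by (intro additive_linext additive_scaled_single)

text \<open>
  In this form \<open>d\<close> is accessible to the commutation relations of the operators.  The truncation to
  \<open>{1..n} - J\<close> in the definition is automatic, since \<open>wedge j\<close> kills \<open>dx\<^sub>J\<close> when \<open>j \<in> J\<close>.
\<close>

lemma deRham_eq: "deRham n \<omega> = (\<Sum>j=1..n. wedge j (pderiv_form j \<omega>))"
proof (rule additive_form_eqI[of "deRham n" "\<lambda>\<omega>. \<Sum>j=1..n. wedge j (pderiv_form j \<omega>)"])
  let ?g = "\<lambda>J f. \<Sum>j \<in> {1..n} - J. Poly_Mapping.single (insert j J)
          ((-1) ^ card {l \<in> J. l < j} * partial_deriv j f)"
  have lin: "deRham n = linext ?g"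
    by (simp add: fun_eq_iff deRham_def linext_def)
  show "additive (deRham n)"
    unfolding lin
    by (intro additive_linext)
      (simp add: additive_def additive.add[OF additive_partial_deriv] distrib_left single_add sum.distrib)
  fix J a c
  have pm: "partial_deriv j (Poly_Mapping.single a c)
      = Poly_Mapping.single (a - Poly_Mapping.single j 1) (int (Poly_Mapping.lookup a j) * c)" for j
    unfolding partial_deriv_linext by (subst linext_single) auto
  have sgn: "(-1) ^ k * Poly_Mapping.single b (x::int) = Poly_Mapping.single b ((-1) ^ k * x)"
    for k and b :: "nat \<Rightarrow>\<^sub>0 nat" and x
    by (induction k) (auto simp: single_uminus)
  have "deRham n (mono_form J a c) = ?g J (Poly_Mapping.single a c)"
    unfolding lin mono_form_def by (rule linext_single) (simp add: additive.zero[OF additive_partial_deriv])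
  also have "\<dots> = (\<Sum>j\<in>{1..n} - J. wedge j (pderiv_form j (mono_form J a c)))"
    by (intro sum.cong refl) (simp add: op_mono, simp add: pm sgn dx_sign_def mono_form_def)
  also have "\<dots> = (\<Sum>j=1..n. wedge j (pderiv_form j (mono_form J a c)))"
    by (intro sum.mono_neutral_left) (auto simp: op_mono)
  finally show "deRham n (mono_form J a c) = (\<Sum>j=1..n. wedge j (pderiv_form j (mono_form J a c)))" .
qed (intro additive_intros op_additive_comp op_additive)

lemma additive_deRham: "additive (deRham n)"
  unfolding deRham_eq[abs_def] by (intro additive_intros op_additive_comp op_additive)

lemmas deRham_add [simp] = additive.add[OF additive_deRham]
lemmas deRham_zero [simp] = additive.zero[OF additive_deRham]
lemmas deRham_minus [simp] = additive.minus[OF additive_deRham]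
lemmas deRham_sum = additive.sum[OF additive_deRham]

lemma form_eq_minus_self:
  fixes \<omega> :: form
  assumes "\<omega> = - \<omega>"
  shows "\<omega> = 0"
proof (intro poly_mapping_eqI)
  fix J a
  have "coeff \<omega> J a = - coeff \<omega> J a"
    by (subst assms) simp
  then show "coeff \<omega> J a = coeff 0 J a" by simp
qed

lemma deRham_wedge: "deRham n (wedge i \<omega>) = - wedge i (deRham n \<omega>)"
  unfolding deRham_eq wedge_sum pderiv_wedge sum_negf[symmetric]
  by (intro sum.cong refl) (rule wedge_wedge)

lemma deRham_deRham [simp]: "deRham n (deRham n \<omega>) = 0"
proof -
  let ?S = "\<Sum>j=1..n. \<Sum>k=1..n. wedge j (wedge k (pderiv_form j (pderiv_form k \<omega>)))"
  have eq: "deRham n (deRham n \<omega>) = ?S"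
    by (simp add: deRham_eq pderiv_form_sum wedge_sum pderiv_wedge)
  have "?S = (\<Sum>k=1..n. \<Sum>j=1..n. wedge j (wedge k (pderiv_form j (pderiv_form k \<omega>))))"
    by (rule sum.swap)
  also have "\<dots> = - ?S"
    unfolding sum_negf[symmetric]
    by (intro sum.cong refl) (subst wedge_wedge, subst pderiv_pderiv, rule refl)
  finally show ?thesis using form_eq_minus_self eq by metis
qed


section \<open>Forms sorted by degree\<close>

text \<open>
  Allowing a set of degrees treats the forms of a fixed degree and the even or odd inhomogeneous
  forms alike.
\<close>

definition forms_in :: "nat \<Rightarrow> nat set \<Rightarrow> form set" where
  "forms_in n D = {\<omega>. supported (\<lambda>J a. J \<subseteq> {1..n} \<and> card J \<in> D \<and> Poly_Mapping.keys a \<subseteq> {1..n}) \<omega>}"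

abbreviation even_forms :: "nat \<Rightarrow> form set" where
  "even_forms n \<equiv> forms_in n {k. even k}"

abbreviation odd_forms :: "nat \<Rightarrow> form set" where
  "odd_forms n \<equiv> forms_in n {k. odd k}"

lemma forms_eq: "forms n i = forms_in n {i}"
proof (intro equalityI subsetI)
  fix \<omega>
  show "\<omega> \<in> forms_in n {i}" if "\<omega> \<in> forms n i"
    unfolding forms_in_def supported_def mem_Collect_eq
  proof (intro allI impI)
    fix J a
    assume "coeff \<omega> J a \<noteq> 0"
    then have "J \<in> Poly_Mapping.keys \<omega>" "a \<in> Poly_Mapping.keys (Poly_Mapping.lookup \<omega> J)"
      by (auto simp: in_keys_iff)
    with that show "J \<subseteq> {1..n} \<and> card J \<in> {i} \<and> Poly_Mapping.keys a \<subseteq> {1..n}"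
      unfolding forms_def by blast
  qed
  show "\<omega> \<in> forms n i" if "\<omega> \<in> forms_in n {i}"
    unfolding forms_def mem_Collect_eq
  proof
    fix J
    assume "J \<in> Poly_Mapping.keys \<omega>"
    then have "Poly_Mapping.lookup \<omega> J \<noteq> 0"
      by (simp add: in_keys_iff)
    then obtain a where "coeff \<omega> J a \<noteq> 0"
      by (metis lookup_zero poly_mapping_eqI)
    with that show "J \<subseteq> {1..n} \<and> card J = i \<and>
        (\<forall>a \<in> Poly_Mapping.keys (Poly_Mapping.lookup \<omega> J). Poly_Mapping.keys a \<subseteq> {1..n})"
      unfolding forms_in_def supported_def by (auto simp: in_keys_iff)
  qed
qed

lemma form_component_eq:
  "form_component m = {\<omega>. supported (\<lambda>J a. a + (\<Sum>j\<in>J. Poly_Mapping.single j 1) = m) \<omega>}"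
proof (intro equalityI subsetI)
  fix \<omega>
  show "\<omega> \<in> {\<omega>. supported (\<lambda>J a. a + (\<Sum>j\<in>J. Poly_Mapping.single j 1) = m) \<omega>}"
    if "\<omega> \<in> form_component m"
    unfolding supported_def mem_Collect_eq
  proof (intro allI impI)
    fix J a
    assume "coeff \<omega> J a \<noteq> 0"
    then have "J \<in> Poly_Mapping.keys \<omega>" "a \<in> Poly_Mapping.keys (Poly_Mapping.lookup \<omega> J)"
      by (auto simp: in_keys_iff)
    with that show "a + (\<Sum>j\<in>J. Poly_Mapping.single j 1) = m"
      unfolding form_component_def by blast
  qed
qed (auto simp: form_component_def supported_def in_keys_iff)

lemma forms_in_zero [simp]: "0 \<in> forms_in n D"
  and forms_in_add: "\<omega> \<in> forms_in n D \<Longrightarrow> \<eta> \<in> forms_in n D \<Longrightarrow> \<omega> + \<eta> \<in> forms_in n D"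
  and forms_in_uminus: "\<omega> \<in> forms_in n D \<Longrightarrow> - \<omega> \<in> forms_in n D"
  and forms_in_diff: "\<omega> \<in> forms_in n D \<Longrightarrow> \<eta> \<in> forms_in n D \<Longrightarrow> \<omega> - \<eta> \<in> forms_in n D"
  by (simp_all add: forms_in_def supported_add supported_uminus supported_diff)

lemma forms_in_sum: "(\<And>i. i \<in> I \<Longrightarrow> f i \<in> forms_in n D) \<Longrightarrow> (\<Sum>i\<in>I. f i) \<in> forms_in n D"
  by (simp add: forms_in_def supported_sum)

lemma forms_in_mono_form:
  "J \<subseteq> {1..n} \<Longrightarrow> card J \<in> D \<Longrightarrow> Poly_Mapping.keys a \<subseteq> {1..n} \<Longrightarrow> mono_form J a c \<in> forms_in n D"
  by (simp add: forms_in_def supported_mono_form)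

lemma forms_in_subset: "D \<subseteq> D' \<Longrightarrow> forms_in n D \<subseteq> forms_in n D'"
  by (auto simp: forms_in_def elim: supported_weaken)

lemma forms_in_induct [consumes 1, case_names zero add mono]:
  assumes "\<omega> \<in> forms_in n D" and "Q 0" and "\<And>\<omega> \<eta>. Q \<omega> \<Longrightarrow> Q \<eta> \<Longrightarrow> Q (\<omega> + \<eta>)"
    and "\<And>J a c. J \<subseteq> {1..n} \<Longrightarrow> card J \<in> D \<Longrightarrow> Poly_Mapping.keys a \<subseteq> {1..n} \<Longrightarrow> Q (mono_form J a c)"
  shows "Q \<omega>"
  using assms(1) unfolding forms_in_def mem_Collect_eq
  by (induction rule: supported_induct) (simp_all only: assms)

lemma wedge_in:
  assumes "\<omega> \<in> forms_in n D" "i \<in> {1..n}" "\<And>k. k \<in> D \<Longrightarrow> Suc k \<in> D'"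
  shows "wedge i \<omega> \<in> forms_in n D'"
  using assms(1)
proof (induction rule: forms_in_induct)
  case (mono J a c)
  then have "finite J" by (meson finite_atLeastAtMost finite_subset)
  with mono assms(2,3) show ?case
    by (auto simp: wedge_mono intro!: forms_in_mono_form)
qed (simp_all add: forms_in_add)

lemma contract_in:
  assumes "\<omega> \<in> forms_in n D" "\<And>k. Suc k \<in> D \<Longrightarrow> k \<in> D'"
  shows "contract i \<omega> \<in> forms_in n D'"
  using assms(1)
proof (induction rule: forms_in_induct)
  case (mono J a c)
  then have "finite J" by (meson finite_atLeastAtMost finite_subset)
  then have "Suc (card (J - {i})) = card J" if "i \<in> J"
    using that by (rule card.remove[symmetric])
  with mono assms(2) show ?case
    by (auto simp: contract_mono intro!: forms_in_mono_form)
qed (simp_all add: forms_in_add)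

lemma xmul_in: "\<omega> \<in> forms_in n D \<Longrightarrow> i \<in> {1..n} \<Longrightarrow> xmul i \<omega> \<in> forms_in n D"
proof (induction rule: forms_in_induct)
  case (mono J a c)
  then show ?case
    using keys_add[of a "Poly_Mapping.single i 1"]
    unfolding xmul_mono by (intro forms_in_mono_form) auto
qed (simp_all add: forms_in_add)

lemma pderiv_in: "\<omega> \<in> forms_in n D \<Longrightarrow> pderiv_form i \<omega> \<in> forms_in n D"
proof (induction rule: forms_in_induct)
  case (mono J a c)
  have "Poly_Mapping.keys (a - Poly_Mapping.single i 1) \<subseteq> Poly_Mapping.keys a"
    by (auto simp: in_keys_iff lookup_minus)
  with mono show ?case
    unfolding pderiv_form_mono by (intro forms_in_mono_form) auto
qed (simp_all add: forms_in_add)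

lemma deRham_in:
  assumes "\<omega> \<in> forms_in n D" "\<And>k. k \<in> D \<Longrightarrow> Suc k \<in> D'"
  shows "deRham n \<omega> \<in> forms_in n D'"
  unfolding deRham_eq by (intro forms_in_sum wedge_in[where D = D] pderiv_in assms)

lemma coeff_reweight: "coeff (reweight g \<omega>) J a = g J a * coeff \<omega> J a"
proof (rule additive_form_eqI[of "\<lambda>\<omega>. coeff (reweight g \<omega>) J a" "\<lambda>\<omega>. g J a * coeff \<omega> J a"])
  show "additive (\<lambda>\<omega>. coeff (reweight g \<omega>) J a)" "additive (\<lambda>\<omega>. g J a * coeff \<omega> J a)"
    by (auto simp: additive_def lookup_add additive.add[OF additive_reweight] distrib_left)
qed (auto simp: reweight_mono coeff_mono_form)

lemma form_eqI: "(\<And>J a. coeff \<omega> J a = coeff \<eta> J a) \<Longrightarrow> \<omega> = \<eta>"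
  by (intro poly_mapping_eqI) auto

lemma supported_reweight: "supported P \<omega> \<Longrightarrow> supported P (reweight g \<omega>)"
  by (auto simp: supported_def coeff_reweight)

definition degree_part :: "nat \<Rightarrow> form \<Rightarrow> form" where
  "degree_part k = reweight (\<lambda>J a. if card J = k then 1 else 0)"

lemma additive_degree_part: "additive (degree_part k)"
  unfolding degree_part_def by (rule additive_reweight)

lemmas degree_part_add [simp] = additive.add[OF additive_degree_part]
lemmas degree_part_zero [simp] = additive.zero[OF additive_degree_part]
lemmas degree_part_diff [simp] = additive.diff[OF additive_degree_part]
lemmas degree_part_sum = additive.sum[OF additive_degree_part]

lemma degree_part_mono: "degree_part k (mono_form J a c) = (if card J = k then mono_form J a c else 0)"
  by (simp add: degree_part_def reweight_mono)

lemma degree_part_in: "\<omega> \<in> forms_in n D \<Longrightarrow> degree_part k \<omega> \<in> forms_in n {k}"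
  by (auto simp: forms_in_def supported_def degree_part_def coeff_reweight)

lemma degree_part_eq:
  assumes "\<omega> \<in> forms_in n {k}"
  shows "degree_part j \<omega> = (if j = k then \<omega> else 0)"
proof (rule form_eqI)
  fix J a
  show "coeff (degree_part j \<omega>) J a = coeff (if j = k then \<omega> else 0) J a"
    using assms unfolding degree_part_def coeff_reweight forms_in_def supported_def by auto
qed

lemma even_form_as_sum:
  assumes "\<omega> \<in> even_forms n"
  shows "\<omega> = (\<Sum>k\<le>n div 2. degree_part (2 * k) \<omega>)"
  using assms
proof (induction rule: forms_in_induct)
  case (add \<omega> \<eta>)
  then show ?case by (simp add: sum.distrib)
next
  case (mono J a c)
  then obtain m where m: "card J = 2 * m" by (auto elim: evenE)
  have "card J \<le> n" using card_mono[OF _ mono(1)] by simp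
  with m have "m \<le> n div 2" by simp
  with m show ?case by (simp add: degree_part_mono)
qed simp

lemma degree_part_deRham:
  assumes "\<omega> \<in> forms_in n D"
  shows "degree_part 0 (deRham n \<omega>) = 0"
    and "degree_part (Suc k) (deRham n \<omega>) = deRham n (degree_part k \<omega>)"
proof -
  have w: "degree_part 0 (wedge j \<omega>) = 0 \<and> degree_part (Suc k) (wedge j \<omega>) = wedge j (degree_part k \<omega>)"
    if "\<omega> \<in> forms_in n D" for j \<omega>
    using that
  proof (induction rule: forms_in_induct)
    case (mono J a c)
    then have "finite J" by (meson finite_atLeastAtMost finite_subset)
    then show ?case
      by (auto simp: wedge_mono degree_part_mono)
  qed (simp_all)
  have p: "degree_part k (pderiv_form j \<omega>) = pderiv_form j (degree_part k \<omega>)" for j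
    by (rule additive_form_eqI[of "\<lambda>\<omega>. degree_part k (pderiv_form j \<omega>)" "\<lambda>\<omega>. pderiv_form j (degree_part k \<omega>)"],
        (intro additive_comp[OF additive_degree_part] additive_comp[OF additive_pderiv_form]
          additive_pderiv_form additive_degree_part)+)
      (auto simp: pderiv_form_mono degree_part_mono)
  show "degree_part 0 (deRham n \<omega>) = 0"
    by (simp add: deRham_eq degree_part_sum w pderiv_in[OF assms])
  show "degree_part (Suc k) (deRham n \<omega>) = deRham n (degree_part k \<omega>)"
    by (simp add: deRham_eq degree_part_sum w pderiv_in[OF assms] p)
qed

text \<open>
  The quotient of the free ring sees inhomogeneous forms, cohomology is defined degree by degree.
  Since \<open>d\<close> raises the degree by one, a primitive can be chosen in each degree separately.
\<close>

lemma exact_iff_degree_parts: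
  assumes "\<omega> \<in> even_forms n"
  shows "\<omega> \<in> deRham n ` odd_forms n \<longleftrightarrow> (\<forall>k. degree_part (2 * k) \<omega> \<in> exact_forms n (2 * k))"
proof
  assume "\<omega> \<in> deRham n ` odd_forms n"
  then obtain \<eta> where \<eta>: "\<eta> \<in> odd_forms n" "\<omega> = deRham n \<eta>" by blast
  show "\<forall>k. degree_part (2 * k) \<omega> \<in> exact_forms n (2 * k)"
  proof
    fix k
    show "degree_part (2 * k) \<omega> \<in> exact_forms n (2 * k)"
    proof (cases k)
      case 0
      then show ?thesis using \<eta> by (simp add: exact_forms_def degree_part_deRham)
    next
      case (Suc l)
      have "degree_part (2 * l + 1) \<eta> \<in> forms n (2 * l + 1)"
        unfolding forms_eq by (rule degree_part_in[OF \<eta>(1)])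
      then show ?thesis
        using \<eta> Suc by (auto simp: exact_forms_def degree_part_deRham(2)[OF \<eta>(1)])
    qed
  qed
next
  assume ex: "\<forall>k. degree_part (2 * k) \<omega> \<in> exact_forms n (2 * k)"
  have "\<exists>\<eta>. \<eta> \<in> odd_forms n \<and> degree_part (2 * k) \<omega> = deRham n \<eta>" for k
  proof (cases k)
    case 0
    then show ?thesis using ex[rule_format, of 0] by (intro exI[of _ 0]) (simp add: exact_forms_def)
  next
    case (Suc l)
    then have "degree_part (2 * k) \<omega> \<in> deRham n ` forms_in n {2 * l + 1}"
      using ex[rule_format, of k] by (simp add: exact_forms_def forms_eq)
    moreover have "forms_in n {2 * l + 1} \<subseteq> odd_forms n"
      by (rule forms_in_subset) auto
    ultimately show ?thesis by blast
  qed
  then obtain \<eta> where \<eta>: "\<And>k. \<eta> k \<in> odd_forms n" "\<And>k. degree_part (2 * k) \<omega> = deRham n (\<eta> k)"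
    by metis
  have "\<omega> = (\<Sum>k\<le>n div 2. deRham n (\<eta> k))"
    using even_form_as_sum[OF assms] by (simp only: \<eta>(2))
  then have "\<omega> = deRham n (\<Sum>k\<le>n div 2. \<eta> k)"
    by (simp only: deRham_sum)
  then show "\<omega> \<in> deRham n ` odd_forms n"
    using forms_in_sum[of "{..n div 2}" \<eta>] \<eta>(1) by blast
qed


section \<open>The Euler homotopy\<close>

text \<open>
  Contraction with the Euler vector field \<open>\<Sum>\<^sub>i x\<^sub>i \<partial>\<^sub>i\<close>.
\<close>

definition euler_contract :: "nat \<Rightarrow> form \<Rightarrow> form" where
  "euler_contract n \<omega> = (\<Sum>i=1..n. xmul i (contract i \<omega>))"

text \<open>
  The total degree, with \<open>x\<^sub>i\<close> and \<open>dx\<^sub>i\<close> both of degree 1.  The intersection with \<open>{1..n}\<close> makes the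
  Cartan formula hold for every form, including those that involve further variables.
\<close>

definition weight :: "nat \<Rightarrow> nat set \<Rightarrow> (nat \<Rightarrow>\<^sub>0 nat) \<Rightarrow> nat" where
  "weight n J a = card (J \<inter> {1..n}) + (\<Sum>i=1..n. Poly_Mapping.lookup a i)"

lemma euler_contract_in:
  assumes "\<omega> \<in> forms_in n D" "\<And>k. Suc k \<in> D \<Longrightarrow> k \<in> D'"
  shows "euler_contract n \<omega> \<in> forms_in n D'"
  unfolding euler_contract_def by (intro forms_in_sum xmul_in contract_in[OF assms])

lemma wedge_contract_mono:
  "wedge i (contract i (mono_form J a c)) = (if i \<in> J then mono_form J a c else 0)"
  by (auto simp: wedge_mono contract_mono dx_sign_remove insert_absorb)

lemma xmul_pderiv_mono:
  "xmul i (pderiv_form i (mono_form J a c)) = mono_form J a (int (Poly_Mapping.lookup a i) * c)"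
proof (cases "Poly_Mapping.lookup a i = 0")
  case False
  then have "a - Poly_Mapping.single i 1 + Poly_Mapping.single i 1 = a"
    by (intro poly_mapping_eqI) (auto simp: lookup_minus lookup_add lookup_single when_def)
  then show ?thesis by (simp add: op_mono)
qed (simp add: op_mono)

lemma mono_form_sum: "mono_form J a (\<Sum>i\<in>I. f i) = (\<Sum>i\<in>I. mono_form J a (f i))"
  by (rule additive.sum[OF additive_mono_form])

text \<open>
  The Lie derivative along the Euler field is multiplication by the total degree.  By the commutation
  relations the mixed terms of \<open>d \<iota>\<close> and \<open>\<iota> d\<close> cancel, and what is left is
  \<open>\<Sum>\<^sub>i (dx\<^sub>i \<and> \<iota>\<^sub>i + x\<^sub>i \<partial>\<^sub>i)\<close>, which counts the differentials and the exponents.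
\<close>

lemma cartan_formula:
  "deRham n (euler_contract n \<omega>) + euler_contract n (deRham n \<omega>) = reweight (\<lambda>J a. int (weight n J a)) \<omega>"
proof -
  have "deRham n (euler_contract n \<omega>)
      = (\<Sum>i=1..n. \<Sum>j=1..n. wedge j (xmul i (pderiv_form j (contract i \<omega>)))
            + (if j = i then wedge j (contract i \<omega>) else 0))"
    unfolding euler_contract_def deRham_sum
    by (simp add: deRham_eq pderiv_xmul if_distrib[of "wedge _"] cong: if_cong)
  also have "\<dots> = (\<Sum>i=1..n. \<Sum>j=1..n. xmul i (wedge j (contract i (pderiv_form j \<omega>))))
        + (\<Sum>i=1..n. wedge i (contract i \<omega>))"
    by (simp add: sum.distrib pderiv_contract xmul_wedge)
  finally have d: "deRham n (euler_contract n \<omega>) = \<dots>" .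
  have "euler_contract n (deRham n \<omega>)
      = (\<Sum>i=1..n. \<Sum>j=1..n. (if i = j then xmul i (pderiv_form j \<omega>) else 0)
            - xmul i (wedge j (contract i (pderiv_form j \<omega>))))"
    by (simp add: euler_contract_def deRham_eq contract_sum xmul_sum contract_wedge if_distrib[of "xmul _"] cong: if_cong)
  also have "\<dots> = (\<Sum>i=1..n. xmul i (pderiv_form i \<omega>))
        - (\<Sum>i=1..n. \<Sum>j=1..n. xmul i (wedge j (contract i (pderiv_form j \<omega>))))"
    by (simp add: sum_subtractf)
  finally have "deRham n (euler_contract n \<omega>) + euler_contract n (deRham n \<omega>)
      = (\<Sum>i=1..n. wedge i (contract i \<omega>)) + (\<Sum>i=1..n. xmul i (pderiv_form i \<omega>))"
    using d by simp
  also have "\<dots> = reweight (\<lambda>J a. int (weight n J a)) \<omega>"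
  proof (rule additive_form_eqI[of "\<lambda>\<omega>. (\<Sum>i=1..n. wedge i (contract i \<omega>)) + (\<Sum>i=1..n. xmul i (pderiv_form i \<omega>))" "reweight (\<lambda>J a. int (weight n J a))"])
    fix J a c
    have "(\<Sum>i=1..n. wedge i (contract i (mono_form J a c))) = (\<Sum>i=1..n. mono_form J a (if i \<in> J then c else 0))"
      by (intro sum.cong refl) (simp add: wedge_contract_mono)
    also have "\<dots> = mono_form J a (int (card (J \<inter> {1..n})) * c)"
      unfolding mono_form_sum[symmetric] by (simp add: sum.If_cases Int_commute)
    finally have 1: "(\<Sum>i=1..n. wedge i (contract i (mono_form J a c))) = \<dots>" .
    have 2: "(\<Sum>i=1..n. xmul i (pderiv_form i (mono_form J a c)))
        = mono_form J a (int (\<Sum>i=1..n. Poly_Mapping.lookup a i) * c)"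
      unfolding xmul_pderiv_mono mono_form_sum[symmetric] by (simp add: sum_distrib_right)
    show "(\<Sum>i=1..n. wedge i (contract i (mono_form J a c))) + (\<Sum>i=1..n. xmul i (pderiv_form i (mono_form J a c)))
        = reweight (\<lambda>J a. int (weight n J a)) (mono_form J a c)"
      unfolding 1 2 reweight_mono weight_def mono_form_add[symmetric] by (simp add: distrib_right)
  qed (intro additive_intros op_additive_comp op_additive)+
  finally show ?thesis .
qed

text \<open>
  The differential preserves the total degree: whenever \<open>dx\<^sub>j \<and> \<partial>\<^sub>j\<close> does not vanish on a monomial, it
  trades one factor \<open>x\<^sub>j\<close> for \<open>dx\<^sub>j\<close>.
\<close>

lemma deRham_reweight:
  "deRham n (reweight (\<lambda>J a. h (weight n J a)) \<omega>) = reweight (\<lambda>J a. h (weight n J a)) (deRham n \<omega>)"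
proof -
  let ?r = "reweight (\<lambda>J a. h (weight n J a))"
  have "wedge j (pderiv_form j (?r \<omega>)) = ?r (wedge j (pderiv_form j \<omega>))" if j: "j \<in> {1..n}" for j
  proof (rule additive_form_eqI[of "\<lambda>\<omega>. wedge j (pderiv_form j (?r \<omega>))" "\<lambda>\<omega>. ?r (wedge j (pderiv_form j \<omega>))"])
    fix J a c
    show "wedge j (pderiv_form j (?r (mono_form J a c))) = ?r (wedge j (pderiv_form j (mono_form J a c)))"
    proof (cases "j \<in> J \<or> Poly_Mapping.lookup a j = 0")
      case False
      let ?b = "a - Poly_Mapping.single j 1"
      have "card (insert j J \<inter> {1..n}) = Suc (card (J \<inter> {1..n}))"
        using j False by simp
      moreover have "(\<Sum>i=1..n. Poly_Mapping.lookup a i) = Suc (\<Sum>i=1..n. Poly_Mapping.lookup ?b i)"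
      proof -
        have "(\<Sum>i\<in>{1..n} - {j}. Poly_Mapping.lookup a i) = (\<Sum>i\<in>{1..n} - {j}. Poly_Mapping.lookup ?b i)"
          by (intro sum.cong refl) (auto simp: lookup_minus lookup_single)
        moreover have "Poly_Mapping.lookup a j = Suc (Poly_Mapping.lookup ?b j)"
          using False by (simp add: lookup_minus)
        ultimately show ?thesis
          using j sum.remove[of "{1..n}" j "Poly_Mapping.lookup a"]
            sum.remove[of "{1..n}" j "Poly_Mapping.lookup ?b"] by simp
      qed
      ultimately have "weight n (insert j J) ?b = weight n J a"
        by (simp add: weight_def)
      then show ?thesis
        using False by (simp add: op_mono mult.left_commute)
    qed (auto simp: op_mono additive.zero[OF additive_reweight])
  qed (intro additive_intros op_additive_comp op_additive)+
  then show ?thesis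
    by (simp add: deRham_eq additive.sum[OF additive_reweight])
qed

lemma sum_constant_form: "(\<Sum>_<N. \<omega>) = reweight (\<lambda>_ _. int N) \<omega>"
proof (rule form_eqI)
  fix J a
  show "coeff (\<Sum>_<N. \<omega>) J a = coeff (reweight (\<lambda>_ _. int N) \<omega>) J a"
    by (induction N) (simp_all add: coeff_reweight lookup_add distrib_right)
qed

lemma weight_bounded: "\<exists>W. supported (\<lambda>J a. weight n J a \<le> W) \<omega>"
proof (induction \<omega> rule: form_induct)
  case (add \<omega> \<eta>)
  then obtain W W' where "supported (\<lambda>J a. weight n J a \<le> W) \<omega>" "supported (\<lambda>J a. weight n J a \<le> W') \<eta>"
    by blast
  then have "supported (\<lambda>J a. weight n J a \<le> max W W') (\<omega> + \<eta>)"
    by (intro supported_add) (auto elim: supported_weaken)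
  then show ?case by blast
next
  case (mono J a c)
  have "supported (\<lambda>J' a'. weight n J' a' \<le> weight n J a) (mono_form J a c)"
    by (rule supported_mono_form) simp
  then show ?case by blast
qed simp

text \<open>
  Over the rationals the homotopy gives the primitive \<open>\<iota> (\<omega> / weight)\<close>.  Multiplying by \<open>W!\<close>, where \<open>W\<close>
  bounds the weights that occur in \<open>\<omega>\<close>, clears all denominators.  Forms of positive degree have positive weight.
\<close>

lemma closed_multiple_exact:
  assumes \<omega>: "\<omega> \<in> even_forms n" and closed: "deRham n \<omega> = 0" and pos: "degree_part 0 \<omega> = 0"
  shows "\<exists>N::nat>0. (\<Sum>_<N. \<omega>) \<in> deRham n ` odd_forms n"
proof -
  obtain W where W: "supported (\<lambda>J a. weight n J a \<le> W) \<omega>"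
    using weight_bounded by blast
  \<comment> \<open>an integer because weights of monomials in the support of \<open>\<omega>\<close> lie between 1 and \<open>W\<close>\<close>
  define h :: "nat \<Rightarrow> int" where "h v = int (fact W div v)" for v
  let ?\<omega>' = "reweight (\<lambda>J a. h (weight n J a)) \<omega>"
  have "deRham n ?\<omega>' = 0"
    by (simp add: deRham_reweight closed additive.zero[OF additive_reweight])
  then have "deRham n (euler_contract n ?\<omega>') = reweight (\<lambda>J a. int (weight n J a)) ?\<omega>'"
    using cartan_formula[of n ?\<omega>']
    by (simp add: euler_contract_def)
  also have "\<dots> = reweight (\<lambda>_ _. int (fact W)) \<omega>"
  proof (rule form_eqI)
    fix J a
    have "int (weight n J a) * h (weight n J a) = int (fact W)" if "coeff \<omega> J a \<noteq> 0"
    proof -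
      have "J \<subseteq> {1..n}"
        using \<omega> that by (auto simp: forms_in_def supported_def)
      moreover have "card J \<noteq> 0"
      proof
        assume "card J = 0"
        then have "coeff (degree_part 0 \<omega>) J a = coeff \<omega> J a"
          by (simp add: degree_part_def coeff_reweight)
        with pos that show False by simp
      qed
      ultimately have "1 \<le> weight n J a"
        by (simp add: weight_def Int_absorb2)
      moreover have "weight n J a \<le> W"
        using W that by (auto simp: supported_def)
      ultimately have "weight n J a * (fact W div weight n J a) = fact W"
        by (intro dvd_mult_div_cancel dvd_fact)
      then show ?thesis
        unfolding h_def of_nat_mult[symmetric] by (rule arg_cong)
    qed
    then show "coeff (reweight (\<lambda>J a. int (weight n J a)) ?\<omega>') J a = coeff (reweight (\<lambda>_ _. int (fact W)) \<omega>) J a"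
      unfolding coeff_reweight mult.assoc[symmetric] by (cases "coeff \<omega> J a = 0") simp_all
  qed
  finally have "(\<Sum>_<(fact W :: nat). \<omega>) = deRham n (euler_contract n ?\<omega>')"
    by (simp only: sum_constant_form)
  moreover have "?\<omega>' \<in> even_forms n"
    using \<omega> by (simp add: forms_in_def supported_reweight)
  then have "euler_contract n ?\<omega>' \<in> odd_forms n"
    by (rule euler_contract_in) simp
  ultimately have "(\<Sum>_<(fact W :: nat). \<omega>) \<in> deRham n ` odd_forms n" by blast
  then show ?thesis by (intro exI[of _ "fact W"]) simp
qed

lemma multiple_exact_closed:
  fixes N :: nat
  assumes "(\<Sum>_<N. \<omega>) \<in> deRham n ` odd_forms n" "N > 0"
  shows "deRham n \<omega> = 0" "degree_part 0 \<omega> = 0"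
proof -
  have cancel: "\<eta> = 0" if "(\<Sum>_<N. \<eta>) = 0" for \<eta> :: form
  proof (rule form_eqI)
    fix J a
    have "coeff (\<Sum>_<N. \<eta>) J a = 0" by (simp add: that)
    then show "coeff \<eta> J a = coeff 0 J a"
      using assms(2) unfolding sum_constant_form coeff_reweight by simp
  qed
  obtain \<eta> where \<eta>: "\<eta> \<in> odd_forms n" "(\<Sum>_<N. \<omega>) = deRham n \<eta>"
    using assms(1) by blast
  have "(\<Sum>_<N. deRham n \<omega>) = deRham n (deRham n \<eta>)"
    unfolding \<eta>(2)[symmetric] by (rule deRham_sum[symmetric])
  then show "deRham n \<omega> = 0" by - (rule cancel, simp)
  have "(\<Sum>_<N. degree_part 0 \<omega>) = degree_part 0 (deRham n \<eta>)"
    unfolding \<eta>(2)[symmetric] by (rule degree_part_sum[symmetric])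
  then show "degree_part 0 \<omega> = 0"
    by - (rule cancel, simp add: degree_part_deRham(1)[OF \<eta>(1)])
qed


section \<open>Normally ordered multiplication by a variable\<close>

text \<open>
  The correction terms of the normally ordered product: \<open>S\<close> is the set of the variables that have to
  be moved past \<open>x\<^sub>i\<close>.
\<close>

definition twist :: "nat \<Rightarrow> nat set \<Rightarrow> form \<Rightarrow> form" where
  "twist i S \<omega> = (\<Sum>k\<in>S. wedge i (wedge k (pderiv_form k \<omega>)))"

definition left_mul :: "nat \<Rightarrow> form \<Rightarrow> form" where
  "left_mul i \<omega> = xmul i \<omega> + twist i {1..<i} \<omega>"

definition right_mul :: "nat \<Rightarrow> nat \<Rightarrow> form \<Rightarrow> form" where
  "right_mul n i \<omega> = xmul i \<omega> - twist i {i<..n} \<omega>"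

lemma additive_twist: "additive (twist i S)"
  unfolding twist_def[abs_def] by (intro additive_intros op_additive_comp op_additive)

lemmas twist_add [simp] = additive.add[OF additive_twist]
lemmas twist_diff [simp] = additive.diff[OF additive_twist]

lemma additive_left_mul: "additive (left_mul i)"
  unfolding left_mul_def[abs_def] by (intro additive_intros op_additive additive_twist)

lemma additive_right_mul: "additive (right_mul n i)"
  unfolding right_mul_def[abs_def] by (intro additive_intros op_additive additive_twist)

lemmas left_mul_add [simp] = additive.add[OF additive_left_mul]
lemmas left_mul_zero [simp] = additive.zero[OF additive_left_mul]
lemmas right_mul_add [simp] = additive.add[OF additive_right_mul]
lemmas right_mul_zero [simp] = additive.zero[OF additive_right_mul]

lemma twist_xmul:
  assumes "finite S"
  shows "twist i S (xmul j \<omega>) = xmul j (twist i S \<omega>) + (if j \<in> S then wedge i (wedge j \<omega>) else 0)"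
proof -
  have "twist i S (xmul j \<omega>)
      = (\<Sum>k\<in>S. xmul j (wedge i (wedge k (pderiv_form k \<omega>))) + (if k = j then wedge i (wedge k \<omega>) else 0))"
    unfolding twist_def by (intro sum.cong refl) (simp add: pderiv_xmul xmul_wedge)
  then show ?thesis
    using assms by (simp add: sum.distrib twist_def xmul_sum)
qed

lemma wedge_pair_commute:
  "wedge i (wedge k (wedge j (wedge l \<omega>))) = wedge j (wedge l (wedge i (wedge k \<omega>)))"
proof -
  have "wedge i (wedge k (wedge j (wedge l \<omega>))) = wedge i (wedge j (wedge l (wedge k \<omega>)))"
    by (simp add: wedge_wedge[of k j] wedge_wedge[of k l])
  also have "\<dots> = wedge j (wedge l (wedge i (wedge k \<omega>)))"
    by (simp add: wedge_wedge[of i j] wedge_wedge[of i l])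
  finally show ?thesis .
qed

lemma twist_twist: "twist i S (twist j S' \<omega>) = twist j S' (twist i S \<omega>)"
proof -
  have "twist i S (twist j S' \<omega>)
      = (\<Sum>k\<in>S. \<Sum>l\<in>S'. wedge i (wedge k (wedge j (wedge l (pderiv_form k (pderiv_form l \<omega>))))))"
    by (simp add: twist_def pderiv_form_sum wedge_sum pderiv_wedge)
  also have "\<dots> = (\<Sum>l\<in>S'. \<Sum>k\<in>S. wedge j (wedge l (wedge i (wedge k (pderiv_form l (pderiv_form k \<omega>))))))"
    by (subst sum.swap, intro sum.cong refl, subst wedge_pair_commute, subst pderiv_pderiv, rule refl)
  also have "\<dots> = twist j S' (twist i S \<omega>)"
    by (simp add: twist_def pderiv_form_sum wedge_sum pderiv_wedge)
  finally show ?thesis .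
qed

text \<open>
  Associativity of the deformed product.  The only contributions to the commutator come from \<open>\<partial>\<^sub>j\<close> in
  \<open>left_mul i\<close> meeting \<open>x\<^sub>j\<close> and from \<open>\<partial>\<^sub>i\<close> in \<open>right_mul n j\<close> meeting \<open>x\<^sub>i\<close>.  Both occur exactly when \<open>j < i\<close>, and
  they cancel by antisymmetry of the wedge product.
\<close>

lemma left_right_commute:
  assumes "1 \<le> j" "i \<le> n"
  shows "left_mul i (right_mul n j \<omega>) = right_mul n j (left_mul i \<omega>)"
  using assms
  by (simp add: left_mul_def right_mul_def twist_xmul twist_twist[of i _ j] xmul_xmul[of i j]
      wedge_wedge[of i j])

text \<open>
  The two correction terms add up to the sum over all variables other than \<open>x\<^sub>i\<close>, and \<open>dx\<^sub>i \<and> dx\<^sub>i = 0\<close>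
  supplies the missing one.  This is how the De Rham differential arises from commutators.
\<close>

lemma left_minus_right:
  assumes "i \<in> {1..n}"
  shows "left_mul i \<omega> - right_mul n i \<omega> = wedge i (deRham n \<omega>)"
proof -
  let ?f = "\<lambda>k. wedge i (wedge k (pderiv_form k \<omega>))"
  have "left_mul i \<omega> - right_mul n i \<omega> = sum ?f {1..<i} + sum ?f {i<..n}"
    by (simp add: left_mul_def right_mul_def twist_def)
  also have "\<dots> = sum ?f ({1..<i} \<union> {i<..n})"
    by (rule sum.union_disjoint[symmetric]) auto
  also have "\<dots> = sum ?f {1..n}"
    using assms by (intro sum.mono_neutral_left) (auto simp: not_less le_less)
  finally show ?thesis by (simp add: deRham_eq wedge_sum)
qed

text \<open>
  Only the operator with the larger index has a correction term that differentiates by the other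
  variable, and antisymmetry of the wedge product makes the result the same for \<open>i < j\<close> and \<open>j < i\<close>.  This
  is why products of commutators represent the forms \<open>dx\<^sub>J\<close>.
\<close>

lemma left_mul_commutator:
  assumes "1 \<le> i" "1 \<le> j"
  shows "left_mul i (left_mul j \<omega>) - left_mul j (left_mul i \<omega>) = wedge i (wedge j \<omega>)"
  using assms
  by (cases i j rule: linorder_cases)
    (simp_all add: left_mul_def twist_xmul twist_twist[of i _ j] xmul_xmul[of i j]
      wedge_wedge[of j i])

lemma twist_in:
  assumes "\<omega> \<in> forms_in n D" "i \<in> {1..n}" "S \<subseteq> {1..n}" "\<And>k. k \<in> D \<Longrightarrow> Suc (Suc k) \<in> D"
  shows "twist i S \<omega> \<in> forms_in n D"
  unfolding twist_def
proof (rule forms_in_sum)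
  fix k
  assume "k \<in> S"
  then have "wedge k (pderiv_form k \<omega>) \<in> forms_in n (Suc ` D)"
    using assms by (intro wedge_in[where D = D] pderiv_in) auto
  then show "wedge i (wedge k (pderiv_form k \<omega>)) \<in> forms_in n D"
    using assms(2,4) by (elim wedge_in) auto
qed

lemma left_mul_in_even:
  assumes "\<omega> \<in> even_forms n" "i \<in> {1..n}"
  shows "left_mul i \<omega> \<in> even_forms n"
  unfolding left_mul_def using assms
  by (intro forms_in_add xmul_in twist_in) auto

text \<open>
  A conjunction of support conditions, so that both can be used in one induction over monomials.
\<close>

lemma graded_eq:
  "forms_in n D \<inter> form_component m = {\<omega>. supported (\<lambda>J a. (J \<subseteq> {1..n} \<and> card J \<in> D \<and>
      Poly_Mapping.keys a \<subseteq> {1..n}) \<and> a + (\<Sum>j\<in>J. Poly_Mapping.single j 1) = m) \<omega>}"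
  unfolding forms_in_def form_component_eq supported_def by blast

lemma form_component_zero [simp]: "0 \<in> form_component m"
  and form_component_add: "\<omega> \<in> form_component m \<Longrightarrow> \<eta> \<in> form_component m \<Longrightarrow> \<omega> + \<eta> \<in> form_component m"
  unfolding form_component_eq by (simp_all add: supported_add)

lemma form_component_sum: "(\<And>i. i \<in> I \<Longrightarrow> f i \<in> form_component m) \<Longrightarrow> (\<Sum>i\<in>I. f i) \<in> form_component m"
  unfolding form_component_eq by (simp add: supported_sum)

lemma graded_induct [consumes 2, case_names zero add mono]:
  assumes "\<omega> \<in> forms_in n D" "\<omega> \<in> form_component m"
    and "Q 0" and "\<And>\<omega> \<eta>. Q \<omega> \<Longrightarrow> Q \<eta> \<Longrightarrow> Q (\<omega> + \<eta>)"
    and mono: "\<And>J a c. J \<subseteq> {1..n} \<Longrightarrow> card J \<in> D \<Longrightarrow> Poly_Mapping.keys a \<subseteq> {1..n} \<Longrightarrow>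
      a + (\<Sum>j\<in>J. Poly_Mapping.single j 1) = m \<Longrightarrow> finite J \<Longrightarrow> Q (mono_form J a c)"
  shows "Q \<omega>"
proof -
  have "\<omega> \<in> forms_in n D \<inter> form_component m" using assms by blast
  then have s: "supported (\<lambda>J a. (J \<subseteq> {1..n} \<and> card J \<in> D \<and>
      Poly_Mapping.keys a \<subseteq> {1..n}) \<and> a + (\<Sum>j\<in>J. Poly_Mapping.single j 1) = m) \<omega>"
    unfolding graded_eq by blast
  show ?thesis
    using s
  proof (induction rule: supported_induct)
    case (mono J a c)
    then show ?case
      by (intro assms(5)) (auto intro: finite_subset)
  qed (simp_all only: assms)
qed

lemma form_component_mono_form:
  "a + (\<Sum>j\<in>J. Poly_Mapping.single j 1) = m \<Longrightarrow> mono_form J a c \<in> form_component m"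
  unfolding form_component_eq by (simp add: supported_mono_form)

lemma wedge_component:
  assumes "\<omega> \<in> forms_in n D" "\<omega> \<in> form_component m"
  shows "wedge i \<omega> \<in> form_component (m + Poly_Mapping.single i 1)"
  using assms
  by (induction rule: graded_induct)
    (auto simp: wedge_mono form_component_add add_ac intro!: form_component_mono_form)

text \<open>
  The truncated subtraction in \<open>pderiv_form\<close> is harmless, because the coefficient vanishes where it matters.
\<close>

lemma wedge_pderiv_component:
  assumes "\<omega> \<in> forms_in n D" "\<omega> \<in> form_component m"
  shows "wedge i (pderiv_form i \<omega>) \<in> form_component m"
  using assms
proof (induction rule: graded_induct)
  case (mono J a c)
  show ?case
  proof (cases "i \<in> J \<or> Poly_Mapping.lookup a i = 0")
    case False
    then have a: "a - Poly_Mapping.single i 1 + Poly_Mapping.single i 1 = a"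
      by (intro poly_mapping_eqI) (auto simp: lookup_minus lookup_add lookup_single when_def)
    have "a - Poly_Mapping.single i 1 + (\<Sum>j\<in>insert i J. Poly_Mapping.single j 1)
        = (a - Poly_Mapping.single i 1 + Poly_Mapping.single i 1) + (\<Sum>j\<in>J. Poly_Mapping.single j 1)"
      using False \<open>finite J\<close> by (simp add: add_ac)
    also have "\<dots> = m" unfolding a by (rule mono)
    finally show ?thesis
      using False by (simp add: op_mono form_component_mono_form)
  qed (auto simp: op_mono)
qed (simp_all add: form_component_add)

lemma left_mul_component:
  assumes "\<omega> \<in> even_forms n" "\<omega> \<in> form_component m" "i \<in> {1..n}"
  shows "left_mul i \<omega> \<in> form_component (m + Poly_Mapping.single i 1)"
proof -
  have "xmul i \<omega> \<in> form_component (m + Poly_Mapping.single i 1)"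
    using assms(1,2)
    by (induction rule: graded_induct)
      (auto simp: xmul_mono form_component_add add_ac intro!: form_component_mono_form)
  moreover have "twist i {1..<i} \<omega> \<in> form_component (m + Poly_Mapping.single i 1)"
    unfolding twist_def
  proof (rule form_component_sum)
    fix k
    assume "k \<in> {1..<i}"
    then have "wedge k (pderiv_form k \<omega>) \<in> odd_forms n"
      using assms by (intro wedge_in[where D = "{k. even k}"] pderiv_in) auto
    then show "wedge i (wedge k (pderiv_form k \<omega>)) \<in> form_component (m + Poly_Mapping.single i 1)"
      using wedge_pderiv_component[OF assms(1,2)] by (rule wedge_component)
  qed
  ultimately show ?thesis
    unfolding left_mul_def by (rule form_component_add)
qed


section \<open>The map from the free ring to differential forms\<close>

type_synonym free = "nat word \<Rightarrow>\<^sub>0 int"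

abbreviation free_carrier :: "nat \<Rightarrow> free set" where
  "free_carrier n \<equiv> carrier (free_ring n)"

definition var :: "nat \<Rightarrow> free" where
  "var i = Poly_Mapping.single (Word [i]) 1"

definition word_poly :: "nat list \<Rightarrow> free" where
  "word_poly ws = Poly_Mapping.single (Word ws) 1"

lemma word_poly_Nil [simp]: "word_poly [] = 1"
  by (simp add: word_poly_def flip: zero_word_def)

lemma word_poly_append: "word_poly (us @ vs) = word_poly us * word_poly vs"
  by (simp add: word_poly_def mult_single plus_word_def)

lemma word_poly_Cons: "word_poly (i # ws) = var i * word_poly ws"
  by (simp add: word_poly_def var_def mult_single plus_word_def)

lemma single_eq_word_poly: "Poly_Mapping.single w c = of_int c * word_poly (letters w)"
proof -
  have "of_int c = Poly_Mapping.single (0 :: nat word) c"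
    by (metis of_int_eq_id id_apply single_of_int)
  then show ?thesis
    by (simp add: word_poly_def mult_single)
qed

lemma free_carrier_iff: "p \<in> free_carrier n \<longleftrightarrow> (\<forall>w \<in> Poly_Mapping.keys p. set (letters w) \<subseteq> {1..n})"
  by (simp add: free_ring_def)

lemma free_carrier_zero [simp]: "0 \<in> free_carrier n"
  and free_carrier_one [simp]: "1 \<in> free_carrier n"
  by (auto simp: free_carrier_iff zero_word_def simp flip: single_one)

lemma free_carrier_add: "p \<in> free_carrier n \<Longrightarrow> q \<in> free_carrier n \<Longrightarrow> p + q \<in> free_carrier n"
  using Poly_Mapping.keys_add[of p q] by (auto simp: free_carrier_iff)

lemma free_carrier_uminus: "p \<in> free_carrier n \<Longrightarrow> - p \<in> free_carrier n"
  by (simp add: free_carrier_iff)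

lemma free_carrier_diff: "p \<in> free_carrier n \<Longrightarrow> q \<in> free_carrier n \<Longrightarrow> p - q \<in> free_carrier n"
  using free_carrier_add[of p n "- q"] free_carrier_uminus[of q n] by simp

lemma free_carrier_mult: "p \<in> free_carrier n \<Longrightarrow> q \<in> free_carrier n \<Longrightarrow> p * q \<in> free_carrier n"
  using keys_mult[of p q] by (fastforce simp: free_carrier_iff plus_word_def)

lemma free_carrier_of_int: "of_int c \<in> free_carrier n"
proof -
  have "of_nat k \<in> free_carrier n" for k
    by (induction k) (simp_all add: free_carrier_add)
  then show ?thesis
    by (cases c rule: int_diff_cases) (simp add: free_carrier_diff)
qed

lemma free_carrier_var: "i \<in> {1..n} \<Longrightarrow> var i \<in> free_carrier n"
  by (simp add: free_carrier_iff var_def)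

lemma free_carrier_word: "set ws \<subseteq> {1..n} \<Longrightarrow> word_poly ws \<in> free_carrier n"
  by (simp add: free_carrier_iff word_poly_def)

lemma free_carrier_word_induct [consumes 1, case_names zero add word]:
  assumes "p \<in> free_carrier n" and "Q 0"
    and "\<And>p q. p \<in> free_carrier n \<Longrightarrow> q \<in> free_carrier n \<Longrightarrow> Q p \<Longrightarrow> Q q \<Longrightarrow> Q (p + q)"
    and "\<And>ws c. set ws \<subseteq> {1..n} \<Longrightarrow> Q (of_int c * word_poly ws)"
  shows "Q p"
proof -
  have "p \<in> free_carrier n \<and> Q p"
  proof (induction p rule: poly_mapping_span_induct)
    case (single w)
    then have "set (letters w) \<subseteq> {1..n}"
      using assms(1) by (simp add: free_carrier_iff)
    then show ?case
      unfolding single_eq_word_poly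
      by (intro conjI free_carrier_mult free_carrier_of_int free_carrier_word assms(4))
  qed (simp_all add: assms(2,3) free_carrier_add)
  then show ?thesis by blast
qed

lemma free_carrier_induct [consumes 1, case_names add of_int var]:
  assumes "p \<in> free_carrier n"
    and "\<And>p q. p \<in> free_carrier n \<Longrightarrow> q \<in> free_carrier n \<Longrightarrow> Q p \<Longrightarrow> Q q \<Longrightarrow> Q (p + q)"
    and of_int: "\<And>c. Q (of_int c)"
    and var: "\<And>i p. i \<in> {1..n} \<Longrightarrow> p \<in> free_carrier n \<Longrightarrow> Q p \<Longrightarrow> Q (var i * p)"
  shows "Q p"
  using assms(1)
proof (induction rule: free_carrier_word_induct)
  case zero
  show ?case using of_int[of 0] by simp
next
  case (word ws c)
  then show ?case
  proof (induction ws)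
    case Nil
    then show ?case using of_int by simp
  next
    case (Cons i ws)
    have "of_int c * word_poly (i # ws) = var i * (of_int c * word_poly ws)"
      unfolding word_poly_Cons mult.assoc[symmetric] by (simp only: mult_of_int_commute)
    also have "Q \<dots>"
      using Cons
      by (intro var free_carrier_mult free_carrier_of_int free_carrier_word) auto
    finally show ?case .
  qed
qed (rule assms(2))

definition to_form :: "free \<Rightarrow> form" where
  "to_form = linext (\<lambda>w c. foldr left_mul (letters w) (mono_form {} 0 c))"

lemma additive_foldr: "(\<And>i. additive (f i)) \<Longrightarrow> additive (foldr f ws)"
  by (induction ws) (simp_all add: additive_def)

lemma additive_to_form_summand: "additive (\<lambda>c. foldr left_mul ws (mono_form {} 0 c))"
  by (intro additive_comp[OF additive_foldr[OF additive_left_mul]] additive_mono_form)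

lemma additive_to_form: "additive to_form"
  unfolding to_form_def by (intro additive_linext additive_to_form_summand)

lemmas to_form_add [simp] = additive.add[OF additive_to_form]
lemmas to_form_minus [simp] = additive.minus[OF additive_to_form]
lemmas to_form_diff [simp] = additive.diff[OF additive_to_form]
lemmas to_form_zero [simp] = additive.zero[OF additive_to_form]
lemmas to_form_sum = additive.sum[OF additive_to_form]

lemma to_form_single: "to_form (Poly_Mapping.single w c) = foldr left_mul (letters w) (mono_form {} 0 c)"
  unfolding to_form_def by (rule linext_single) (rule additive.zero[OF additive_to_form_summand])

lemma to_form_of_int: "to_form (of_int c) = mono_form {} 0 c"
  using to_form_single[of "Word []" c] by (simp add: single_eq_word_poly)

lemma to_form_var_left: "to_form (var i * p) = left_mul i (to_form p)"
proof (induction p rule: poly_mapping_span_induct)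
  case (single w)
  show ?case by (simp add: var_def mult_single plus_word_def to_form_single)
qed (simp_all add: distrib_left)

lemma to_form_word: "to_form (word_poly ws * p) = foldr left_mul ws (to_form p)"
  by (induction ws) (simp_all add: word_poly_Cons mult.assoc to_form_var_left)

lemma pderiv_const [simp]: "pderiv_form i (mono_form J 0 c) = 0"
  by (simp add: pderiv_form_mono)

text \<open>
  On constants \<open>left_mul\<close> and \<open>right_mul\<close> agree; from there \<open>left_right_commute\<close> moves the right
  multiplication through all letters of a word.
\<close>

lemma to_form_var_right:
  assumes "p \<in> free_carrier n" "i \<in> {1..n}"
  shows "to_form (p * var i) = right_mul n i (to_form p)"
  using assms(1)
proof (induction rule: free_carrier_induct)
  case (of_int c)
  have "to_form (of_int c * var i) = left_mul i (mono_form {} 0 c)"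
    by (simp add: mult_of_int_commute to_form_var_left to_form_of_int)
  then show ?case
    by (simp add: to_form_of_int left_mul_def right_mul_def twist_def)
next
  case (var j p)
  then show ?case
    using assms(2) by (simp add: mult.assoc to_form_var_left left_right_commute)
qed (simp add: distrib_right)

lemma to_form_commutator:
  assumes "p \<in> free_carrier n" "i \<in> {1..n}"
  shows "to_form (var i * p - p * var i) = wedge i (deRham n (to_form p))"
  using assms by (simp add: to_form_var_left to_form_var_right left_minus_right)

lemma to_form_var_commutator:
  assumes "1 \<le> i" "1 \<le> j"
  shows "to_form ((var i * var j - var j * var i) * p) = wedge i (wedge j (to_form p))"
  using assms by (simp add: left_diff_distrib mult.assoc to_form_var_left left_mul_commutator)

lemma to_form_even: "p \<in> free_carrier n \<Longrightarrow> to_form p \<in> even_forms n"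
  by (induction rule: free_carrier_induct)
    (auto simp: to_form_of_int to_form_var_left intro: forms_in_add forms_in_mono_form left_mul_in_even)

text \<open>
  This and the next lemma show that the kernel of \<open>to_form\<close> is a two-sided ideal, although \<open>to_form\<close> is
  not presented as a ring homomorphism.
\<close>

lemma to_form_kernel_left:
  assumes "a \<in> free_carrier n" "to_form p = 0"
  shows "to_form (a * p) = 0"
  using assms(1)
proof (induction rule: free_carrier_induct)
  case (of_int c)
  have "to_form (of_nat k * p) = 0" for k
    by (induction k) (simp_all add: distrib_right assms(2))
  then show ?case
    by (cases c rule: int_diff_cases) (simp add: left_diff_distrib)
qed (simp_all add: distrib_right mult.assoc to_form_var_left)

lemma to_form_kernel_right:
  assumes "a \<in> free_carrier n" "p \<in> free_carrier n" "to_form p = 0"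
  shows "to_form (p * a) = 0"
  using assms(1,2,3)
proof (induction arbitrary: p rule: free_carrier_induct)
  case (of_int c)
  then show ?case
    using to_form_kernel_left[of "of_int c" n p] by (simp add: mult_of_int_commute free_carrier_of_int)
next
  case (var i q)
  then show ?case
    by (simp add: to_form_var_right free_carrier_mult free_carrier_var flip: mult.assoc)
qed (simp add: distrib_left)


section \<open>The lower central series of the free ring\<close>

definition commutator :: "'a::ring \<Rightarrow> 'a \<Rightarrow> 'a" where
  "commutator a b = a * b - b * a"

lemma free_ring_simps [simp]:
  "(\<otimes>\<^bsub>free_ring n\<^esub>) = (*)" "\<one>\<^bsub>free_ring n\<^esub> = 1" "\<zero>\<^bsub>free_ring n\<^esub> = 0" "(\<oplus>\<^bsub>free_ring n\<^esub>) = (+)"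
  by (simp_all add: free_ring_def)

lemma abelian_group_free_ring: "abelian_group (free_ring n)"
  using ring_free_ring by (rule ring.is_abelian_group)

lemma group_free_ring: "group (add_monoid (free_ring n))"
  using abelian_group.a_group[OF abelian_group_free_ring] .

lemma a_inv_free_ring: "p \<in> free_carrier n \<Longrightarrow> \<ominus>\<^bsub>free_ring n\<^esub> p = - p"
  by (rule abelian_group.minus_equality[OF abelian_group_free_ring])
    (simp_all add: free_carrier_uminus)

lemma a_minus_free_ring:
  "q \<in> free_carrier n \<Longrightarrow> p \<ominus>\<^bsub>free_ring n\<^esub> q = p - q"
  by (simp add: a_minus_def a_inv_free_ring)

abbreviation span :: "nat \<Rightarrow> free set \<Rightarrow> free set" where
  "span n S \<equiv> generate (add_monoid (free_ring n)) S"

lemma span_zero: "0 \<in> span n S"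
  using generate.one[of "add_monoid (free_ring n)" S] by simp

lemma span_add: "p \<in> span n S \<Longrightarrow> q \<in> span n S \<Longrightarrow> p + q \<in> span n S"
  using generate.eng[of p "add_monoid (free_ring n)" S q] by simp

lemma span_carrier: "S \<subseteq> free_carrier n \<Longrightarrow> span n S \<subseteq> free_carrier n"
  using group.generate_incl[OF group_free_ring, of S n] by simp

lemma span_uminus: "S \<subseteq> free_carrier n \<Longrightarrow> p \<in> span n S \<Longrightarrow> - p \<in> span n S"
  using group.generate_m_inv_closed[OF group_free_ring, of S n p] span_carrier[of S n] a_inv_free_ring[of p n]
  by (auto simp: a_inv_def)

lemma span_diff: "S \<subseteq> free_carrier n \<Longrightarrow> p \<in> span n S \<Longrightarrow> q \<in> span n S \<Longrightarrow> p - q \<in> span n S"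
  using span_add[of p n S "- q"] span_uminus[of S n q] by simp

lemma span_induct [consumes 2, case_names zero gen add uminus]:
  assumes "p \<in> span n S" "S \<subseteq> free_carrier n"
    and "Q 0" "\<And>p. p \<in> S \<Longrightarrow> Q p" "\<And>p q. Q p \<Longrightarrow> Q q \<Longrightarrow> Q (p + q)" "\<And>p. Q p \<Longrightarrow> Q (- p)"
  shows "Q p"
  using assms(1)
proof (induction rule: generate.induct)
  case (inv h)
  then have "inv\<^bsub>add_monoid (free_ring n)\<^esub> h = - h"
    using assms(2) a_inv_free_ring[of h n] by (auto simp: a_inv_def)
  then show ?case using inv assms(4,6) by simp
qed (simp_all add: assms(3,4,5))

abbreviation L2 :: "nat \<Rightarrow> free set" where "L2 n \<equiv> lcs (free_ring n) 2"
abbreviation L3 :: "nat \<Rightarrow> free set" where "L3 n \<equiv> lcs (free_ring n) 3"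
abbreviation M3 :: "nat \<Rightarrow> free set" where "M3 n \<equiv> lcs_ideal (free_ring n) 3"

lemma lcs_step:
  assumes "lcs (free_ring n) (Suc k) \<subseteq> free_carrier n"
  shows "lcs (free_ring n) (Suc (Suc k))
    = span n {commutator a b | a b. a \<in> free_carrier n \<and> b \<in> lcs (free_ring n) (Suc k)}"
proof -
  have "(a \<otimes>\<^bsub>free_ring n\<^esub> b) \<ominus>\<^bsub>free_ring n\<^esub> (b \<otimes>\<^bsub>free_ring n\<^esub> a) = commutator a b"
    if "a \<in> free_carrier n" "b \<in> lcs (free_ring n) (Suc k)" for a b
    using that assms by (auto simp: a_minus_free_ring commutator_def free_carrier_mult subset_iff)
  then have "{(a \<otimes>\<^bsub>free_ring n\<^esub> b) \<ominus>\<^bsub>free_ring n\<^esub> (b \<otimes>\<^bsub>free_ring n\<^esub> a) | a b.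
        a \<in> free_carrier n \<and> b \<in> lcs (free_ring n) (Suc k)}
      = {commutator a b | a b. a \<in> free_carrier n \<and> b \<in> lcs (free_ring n) (Suc k)}"
    by force
  then show ?thesis unfolding lcs.simps by (rule arg_cong)
qed

lemma commutators_carrier:
  "B \<subseteq> free_carrier n \<Longrightarrow> {commutator a b | a b. a \<in> free_carrier n \<and> b \<in> B} \<subseteq> free_carrier n"
  by (auto simp: commutator_def intro: free_carrier_diff free_carrier_mult)

lemma L2_eq: "L2 n = span n {commutator a b | a b. a \<in> free_carrier n \<and> b \<in> free_carrier n}"
  using lcs_step[of n 0] by (simp add: numeral_2_eq_2)

lemma L2_gens: "{commutator a b | a b. a \<in> free_carrier n \<and> b \<in> free_carrier n} \<subseteq> free_carrier n"
  by (rule commutators_carrier) simp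

lemma L2_carrier: "L2 n \<subseteq> free_carrier n"
  unfolding L2_eq by (rule span_carrier[OF L2_gens])

lemma L3_eq: "L3 n = span n {commutator a b | a b. a \<in> free_carrier n \<and> b \<in> L2 n}"
  using lcs_step[of n 1] L2_carrier[of n] by (simp add: numeral_3_eq_3 numeral_2_eq_2)

lemma L3_gens: "{commutator a b | a b. a \<in> free_carrier n \<and> b \<in> L2 n} \<subseteq> free_carrier n"
  by (rule commutators_carrier[OF L2_carrier])

lemma L3_carrier: "L3 n \<subseteq> free_carrier n"
  unfolding L3_eq by (rule span_carrier[OF L3_gens])

lemma commutator_L2: "a \<in> free_carrier n \<Longrightarrow> b \<in> free_carrier n \<Longrightarrow> commutator a b \<in> L2 n"
  unfolding L2_eq by (rule generate.incl) blast

lemma commutator_L3: "a \<in> free_carrier n \<Longrightarrow> b \<in> L2 n \<Longrightarrow> commutator a b \<in> L3 n"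
  unfolding L3_eq by (rule generate.incl) blast

lemma L3_subset_L2: "L3 n \<subseteq> L2 n"
  unfolding L3_eq L2_eq[of n]
  by (intro group.mono_generate[OF group_free_ring]) (use L2_carrier in \<open>unfold L2_eq, blast\<close>)

lemma M3_eq: "M3 n = span n {a * b | a b. a \<in> free_carrier n \<and> b \<in> L3 n}"
  by (simp add: lcs_ideal_def)

lemma M3_gens: "{a * b | a b. a \<in> free_carrier n \<and> b \<in> L3 n} \<subseteq> free_carrier n"
  using L3_carrier[of n] by (auto intro: free_carrier_mult)

lemma M3_carrier: "M3 n \<subseteq> free_carrier n"
  unfolding M3_eq by (rule span_carrier[OF M3_gens])

lemma M3_zero [simp]: "0 \<in> M3 n"
  and M3_add: "p \<in> M3 n \<Longrightarrow> q \<in> M3 n \<Longrightarrow> p + q \<in> M3 n"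
  and M3_uminus: "p \<in> M3 n \<Longrightarrow> - p \<in> M3 n"
  and M3_diff: "p \<in> M3 n \<Longrightarrow> q \<in> M3 n \<Longrightarrow> p - q \<in> M3 n"
  unfolding M3_eq
  by (rule span_zero, erule (1) span_add, erule span_uminus[OF M3_gens], erule (1) span_diff[OF M3_gens])

lemma M3_gen: "a \<in> free_carrier n \<Longrightarrow> l \<in> L3 n \<Longrightarrow> a * l \<in> M3 n"
  unfolding M3_eq by (rule generate.incl) blast

lemma L3_subset_M3: "L3 n \<subseteq> M3 n"
  using M3_gen[of 1 n] by auto

lemma M3_left:
  assumes "a \<in> free_carrier n" "p \<in> M3 n"
  shows "a * p \<in> M3 n"
  using assms(2)[unfolded M3_eq] M3_gens
proof (induction rule: span_induct)
  case (gen p)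
  then obtain b l where bl: "p = b * l" "b \<in> free_carrier n" "l \<in> L3 n" by blast
  then have "a * p = (a * b) * l" by (simp add: mult.assoc)
  with bl assms(1) show ?case
    using M3_gen[of "a * b" n l] free_carrier_mult by simp
qed (simp_all add: distrib_left M3_add M3_uminus)

text \<open>
  \<open>M\<^sub>3\<close> is a left ideal by construction; moving a factor past \<open>L\<^sub>3\<close> costs a commutator that lies in
  \<open>L\<^sub>3\<close> again.
\<close>

lemma M3_right:
  assumes "a \<in> free_carrier n" "p \<in> M3 n"
  shows "p * a \<in> M3 n"
  using assms(2)[unfolded M3_eq] M3_gens
proof (induction rule: span_induct)
  case (gen p)
  then obtain b l where bl: "p = b * l" "b \<in> free_carrier n" "l \<in> L3 n" by blast
  then have "p * a = (b * a) * l - b * commutator a l"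
    by (simp add: commutator_def mult.assoc right_diff_distrib)
  moreover have "commutator a l \<in> L3 n"
    using assms(1) bl(3) L3_subset_L2 by (intro commutator_L3) auto
  ultimately show ?case
    using bl assms(1) M3_gen[of "b * a" n l] M3_gen[of b n "commutator a l"] free_carrier_mult M3_diff
    by simp
qed (simp_all add: distrib_right M3_add M3_uminus)

lemma commutator_central:
  assumes "a \<in> free_carrier n" "b \<in> free_carrier n" "c \<in> free_carrier n"
  shows "commutator a (commutator b c) \<in> M3 n"
  using commutator_L3[OF assms(1) commutator_L2[OF assms(2,3)]] L3_subset_M3 by blast

lemma commutator_carrier: "a \<in> free_carrier n \<Longrightarrow> b \<in> free_carrier n \<Longrightarrow> commutator a b \<in> free_carrier n"
  using commutator_L2 L2_carrier by blast

text \<open>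
  Expand \<open>[a, [b c, d]]\<close>, which lies in \<open>L\<^sub>3\<close>, by the Leibniz rule: the terms with a double commutator lie
  in \<open>M\<^sub>3\<close>, and what remains are two products of commutators.  The last correction brings the second
  of them into the stated order.
\<close>

lemma commutator_exchange:
  assumes abcd: "a \<in> free_carrier n" "b \<in> free_carrier n" "c \<in> free_carrier n" "d \<in> free_carrier n"
  shows "commutator a b * commutator c d + commutator a c * commutator b d \<in> M3 n"
proof -
  have "commutator a b * commutator c d + commutator a c * commutator b d
      = commutator a (commutator (b * c) d) - b * commutator a (commutator c d)
        - commutator a (commutator b d) * c - commutator (commutator b d) (commutator a c)"
    by (simp add: commutator_def algebra_simps)
  also have "\<dots> \<in> M3 n"
    by (intro M3_diff M3_left M3_right commutator_central free_carrier_mult commutator_carrier abcd)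
  finally show ?thesis .
qed


section \<open>The images of the lower central series\<close>

text \<open>
  Reduce \<open>[p, b]\<close> to commutators with a variable by \<open>[x\<^sub>i p, b] = [x\<^sub>i, p b] + [p, b x\<^sub>i]\<close>, and use
  \<open>dx\<^sub>i \<and> d\<omega> = - d (dx\<^sub>i \<and> \<omega>)\<close>.
\<close>

lemma to_form_L2:
  assumes "p \<in> L2 n"
  shows "to_form p \<in> deRham n ` odd_forms n"
proof -
  let ?E = "deRham n ` odd_forms n"
  have E_add: "\<omega> + \<eta> \<in> ?E" if "\<omega> \<in> ?E" "\<eta> \<in> ?E" for \<omega> \<eta>
    using that forms_in_add by (force simp flip: deRham_add)
  have E_uminus: "- \<omega> \<in> ?E" if "\<omega> \<in> ?E" for \<omega>
    using that forms_in_uminus by (force simp flip: deRham_minus)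
  have E_zero: "0 \<in> ?E"
    by (rule image_eqI[of _ _ 0]) simp_all
  have gen: "to_form (commutator a b) \<in> ?E" if "a \<in> free_carrier n" "b \<in> free_carrier n" for a b
    using that
  proof (induction arbitrary: b rule: free_carrier_induct)
    case (add p q)
    have "commutator (p + q) b = commutator p b + commutator q b"
      by (simp add: commutator_def algebra_simps)
    with add E_add show ?case by simp
  next
    case (of_int c)
    have "commutator (of_int c) b = 0"
      by (simp add: commutator_def mult_of_int_commute)
    then show ?case by (simp add: E_zero)
  next
    case (var i p)
    have eq: "commutator (var i * p) b = (var i * (p * b) - (p * b) * var i) + commutator p (b * var i)"
      by (simp add: commutator_def algebra_simps)
    have "to_form (var i * (p * b) - (p * b) * var i) = deRham n (- wedge i (to_form (p * b)))"
      using var free_carrier_mult[of p n b]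
      by (simp add: to_form_commutator deRham_wedge del: to_form_diff)
    moreover have "- wedge i (to_form (p * b)) \<in> odd_forms n"
      using var free_carrier_mult[of p n b]
      by (intro forms_in_uminus wedge_in[where D = "{k. even k}"] to_form_even) auto
    ultimately have "to_form (var i * (p * b) - (p * b) * var i) \<in> ?E" by blast
    moreover have "to_form (commutator p (b * var i)) \<in> ?E"
      using var by (intro var.IH) (simp add: free_carrier_mult free_carrier_var)
    ultimately show ?case
      unfolding eq by (subst to_form_add) (rule E_add)
  qed
  from assms[unfolded L2_eq] L2_gens show ?thesis
    by (induction rule: span_induct) (auto simp: E_zero E_add E_uminus gen)
qed

text \<open>
  Elements of \<open>L\<^sub>2\<close> have closed images, hence \<open>[x\<^sub>i, b]\<close> is sent to \<open>dx\<^sub>i \<and> d (to_form b) = 0\<close> for \<open>b \<in> L\<^sub>2\<close>.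
  The Leibniz rule and the ideal property of the kernel extend this from \<open>x\<^sub>i\<close> to all of \<open>A\<close>.
\<close>

lemma to_form_L3:
  assumes "p \<in> L3 n"
  shows "to_form p = 0"
proof -
  have gen: "to_form (commutator a b) = 0" if a: "a \<in> free_carrier n" and b: "b \<in> L2 n" for a b
    using a
  proof (induction rule: free_carrier_induct)
    case (add p q)
    have "commutator (p + q) b = commutator p b + commutator q b"
      by (simp add: commutator_def algebra_simps)
    with add show ?case by simp
  next
    case (of_int c)
    have "commutator (of_int c) b = 0"
      by (simp add: commutator_def mult_of_int_commute)
    then show ?case by simp
  next
    case (var i p)
    have eq: "commutator (var i * p) b = var i * commutator p b + commutator (var i) b * p"
      by (simp add: commutator_def algebra_simps)
    have bc: "b \<in> free_carrier n"
      using b L2_carrier by blast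
    have "deRham n (to_form b) = 0"
      using to_form_L2[OF b] by auto
    then have "to_form (commutator (var i) b) = 0"
      using var bc unfolding commutator_def by (simp add: to_form_commutator del: to_form_diff)
    moreover have "commutator (var i) b \<in> free_carrier n"
      using var bc by (intro commutator_carrier free_carrier_var)
    ultimately have "to_form (commutator (var i) b * p) = 0"
      using var by (intro to_form_kernel_right)
    with var show ?case
      unfolding eq by (simp add: to_form_var_left)
  qed
  from assms[unfolded L3_eq] L3_gens show ?thesis
    by (induction rule: span_induct) (auto simp: gen)
qed

lemma to_form_M3:
  assumes "p \<in> M3 n"
  shows "to_form p = 0"
  using assms[unfolded M3_eq] M3_gens
  by (induction rule: span_induct) (auto intro: to_form_kernel_left to_form_L3)


section \<open>Normal forms in the free ring\<close>

text \<open>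
  Consecutive letters are paired, \<open>[x\<^sub>j\<^sub>1, x\<^sub>j\<^sub>2] [x\<^sub>j\<^sub>3, x\<^sub>j\<^sub>4] \<dots>\<close>; on lists of odd length the last letter is dropped.
\<close>

fun pair_commutators :: "nat list \<Rightarrow> free" where
  "pair_commutators (i # j # ks) = commutator (var i) (var j) * pair_commutators ks"
| "pair_commutators _ = 1"

text \<open>
  The letters of the monomial with exponent vector \<open>a\<close>, in increasing order.
\<close>

definition exponent_word :: "nat \<Rightarrow> (nat \<Rightarrow>\<^sub>0 nat) \<Rightarrow> nat list" where
  "exponent_word n a = concat (map (\<lambda>k. replicate (Poly_Mapping.lookup a k) k) [1..<Suc n])"

definition from_form :: "nat \<Rightarrow> form \<Rightarrow> free" where
  "from_form n = form_ext (\<lambda>J a c.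
      of_int c * (word_poly (exponent_word n a) * pair_commutators (sorted_list_of_set J)))"

lemma from_form_summand: "additive (\<lambda>c. of_int c * (p :: free))"
  by (simp add: additive_def distrib_right)

lemma additive_from_form: "additive (from_form n)"
  unfolding from_form_def by (intro additive_form_ext from_form_summand)

lemmas from_form_add [simp] = additive.add[OF additive_from_form]
lemmas from_form_diff [simp] = additive.diff[OF additive_from_form]
lemmas from_form_zero [simp] = additive.zero[OF additive_from_form]

lemma from_form_mono: "from_form n (mono_form J a c)
    = of_int c * (word_poly (exponent_word n a) * pair_commutators (sorted_list_of_set J))"
  unfolding from_form_def by (rule form_ext_mono[OF from_form_summand])

lemma set_exponent_word: "set (exponent_word n a) \<subseteq> {1..n}"
  by (auto simp: exponent_word_def)

lemma sorted_exponent_word: "sorted (exponent_word n a)"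
proof (induction n)
  case (Suc n)
  have "exponent_word (Suc n) a = exponent_word n a @ replicate (Poly_Mapping.lookup a (Suc n)) (Suc n)"
    by (simp add: exponent_word_def)
  then show ?case
    using Suc set_exponent_word[of n a] by (auto simp: sorted_append)
qed (simp add: exponent_word_def)

lemma count_exponent_word:
  "count (mset (exponent_word n a)) k = (if k \<in> {1..n} then Poly_Mapping.lookup a k else 0)"
proof (induction n)
  case (Suc n)
  have "exponent_word (Suc n) a = exponent_word n a @ replicate (Poly_Mapping.lookup a (Suc n)) (Suc n)"
    by (simp add: exponent_word_def)
  then show ?case
    using Suc by auto
qed (simp add: exponent_word_def)

lemma word_mdeg_Cons: "word_mdeg (Word (i # ws)) = Poly_Mapping.single i 1 + word_mdeg (Word ws)"
  by (simp add: word_mdeg_def)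

lemma word_mdeg_Nil: "word_mdeg (Word []) = 0"
  by (simp add: word_mdeg_def)

lemma lookup_word_mdeg: "Poly_Mapping.lookup (word_mdeg (Word ws)) k = count (mset ws) k"
  by (induction ws) (auto simp: word_mdeg_Cons word_mdeg_Nil lookup_add lookup_single when_def)

lemma word_mdeg_exponent_word:
  "Poly_Mapping.keys a \<subseteq> {1..n} \<Longrightarrow> word_mdeg (Word (exponent_word n a)) = a"
  by (rule poly_mapping_eqI) (auto simp: lookup_word_mdeg count_exponent_word in_keys_iff)

lemma mset_exponent_word:
  "set ws \<subseteq> {1..n} \<Longrightarrow> mset (exponent_word n (word_mdeg (Word ws))) = mset ws"
  by (rule multiset_eqI) (auto simp: lookup_word_mdeg count_exponent_word count_eq_zero_iff subset_iff)

lemma pair_commutators_carrier: "set js \<subseteq> {1..n} \<Longrightarrow> pair_commutators js \<in> free_carrier n"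
  by (induction js rule: pair_commutators.induct)
    (auto intro!: free_carrier_mult commutator_carrier free_carrier_var)

lemma from_form_carrier: "\<omega> \<in> forms_in n D \<Longrightarrow> from_form n \<omega> \<in> free_carrier n"
proof (induction rule: forms_in_induct)
  case (mono J a c)
  then have "finite J" by (meson finite_atLeastAtMost finite_subset)
  with mono show ?case
    unfolding from_form_mono
    by (intro free_carrier_mult free_carrier_of_int free_carrier_word pair_commutators_carrier
        set_exponent_word) simp
qed (simp_all add: free_carrier_add)

text \<open>
  Building up a sorted list from its end, each new \<open>dx\<close> is inserted at the front, so no signs occur.
\<close>

lemma to_form_pair_commutators:
  assumes "sorted js" "distinct js" "even (length js)" "\<forall>j\<in>set js. 1 \<le> j"
  shows "to_form (of_int c * pair_commutators js) = mono_form (set js) 0 c"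
  using assms
proof (induction js rule: pair_commutators.induct)
  case (1 i j ks)
  have "of_int c * pair_commutators (i # j # ks)
      = (var i * var j - var j * var i) * (of_int c * pair_commutators ks)"
    unfolding pair_commutators.simps commutator_def mult.assoc[symmetric]
    by (simp only: mult_of_int_commute)
  then have "to_form (of_int c * pair_commutators (i # j # ks)) = wedge i (wedge j (mono_form (set ks) 0 c))"
    using 1 by (simp add: to_form_var_commutator del: to_form_diff)
  moreover have "{l \<in> insert j (set ks). l < i} = {}" "{l \<in> set ks. l < j} = {}"
    using 1 by auto
  then have "dx_sign i (insert j (set ks)) = 1" "dx_sign j (set ks) = 1"
    by (simp_all only: dx_sign_def card.empty power_0)
  ultimately show ?case
    using 1 by (simp add: wedge_mono)
qed (auto simp: to_form_of_int)

text \<open>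
  In a sorted word the letters to the right of \<open>x\<^sub>i\<close> have index at least \<open>i\<close>, while the correction terms of
  \<open>left_mul i\<close> differentiate only by variables of smaller index.  So no correction arises.
\<close>

lemma foldr_left_mul_mono:
  assumes "sorted ws"
  shows "foldr left_mul ws (mono_form J 0 c) = mono_form J (word_mdeg (Word ws)) c"
  using assms
proof (induction ws)
  case (Cons i ws)
  let ?b = "word_mdeg (Word ws)"
  have "wedge i (wedge k (pderiv_form k (mono_form J ?b c))) = 0" if "k < i" for k
  proof -
    have "k \<notin> set ws" using Cons.prems that by auto
    then have "Poly_Mapping.lookup ?b k = 0"
      by (simp add: lookup_word_mdeg count_eq_zero_iff)
    then show ?thesis by (simp add: pderiv_form_mono)
  qed
  then show ?case
    using Cons by (simp add: left_mul_def twist_def xmul_mono word_mdeg_Cons add_ac)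
qed (simp add: word_mdeg_Nil)

lemma to_form_from_form:
  assumes "\<omega> \<in> even_forms n"
  shows "to_form (from_form n \<omega>) = \<omega>"
  using assms
proof (induction rule: forms_in_induct)
  case (mono J a c)
  then have fin: "finite J" by (meson finite_atLeastAtMost finite_subset)
  have "of_int c * (word_poly (exponent_word n a) * pair_commutators (sorted_list_of_set J))
      = word_poly (exponent_word n a) * (of_int c * pair_commutators (sorted_list_of_set J))"
    unfolding mult.assoc[symmetric] by (simp only: mult_of_int_commute)
  moreover have "to_form (of_int c * pair_commutators (sorted_list_of_set J)) = mono_form J 0 c"
    using mono fin by (subst to_form_pair_commutators) auto
  ultimately show ?case
    using mono
    by (simp add: from_form_mono to_form_word foldr_left_mul_mono sorted_exponent_word word_mdeg_exponent_word)
qed simp_all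


section \<open>Every element is congruent to a normal form\<close>

text \<open>
  Swaps need only be known for rearrangements of the given multiset \<open>M\<close>.  This retains information about
  the letters and the length, which the applications need.
\<close>

lemma permutation_by_adjacent_swaps:
  assumes refl: "\<And>xs. R xs xs" and trans: "\<And>xs ys zs. R xs ys \<Longrightarrow> R ys zs \<Longrightarrow> R xs zs"
    and swap: "\<And>us a b vs. mset (us @ a # b # vs) = M \<Longrightarrow> R (us @ a # b # vs) (us @ b # a # vs)"
    and "mset xs = M" "mset ys = M"
  shows "R xs ys"
proof -
  \<comment> \<open>bring the required first letter to the front; the rest follows by induction with a longer prefix\<close>
  have move: "R (pre @ us @ y # vs) (pre @ y # us @ vs)"
    if "mset (pre @ us @ y # vs) = M" for pre us y vs
    using that
  proof (induction us arbitrary: vs rule: rev_induct)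
    case Nil
    show ?case by (simp add: refl)
  next
    case (snoc u us)
    have "R (pre @ us @ u # y # vs) (pre @ us @ y # u # vs)"
      using swap[of "pre @ us" u y vs] snoc.prems by simp
    moreover have "R (pre @ us @ y # u # vs) (pre @ y # us @ u # vs)"
      using snoc.prems by (intro snoc.IH) (simp add: add_mset_commute)
    ultimately have "R (pre @ us @ u # y # vs) (pre @ y # us @ u # vs)"
      by (rule trans)
    then show ?case by simp
  qed
  have "R (pre @ xs) (pre @ ys)" if "mset xs = mset ys" "mset (pre @ xs) = M" for pre xs ys
    using that
  proof (induction ys arbitrary: pre xs)
    case Nil
    then show ?case by (simp add: refl)
  next
    case (Cons y ys)
    then have "y \<in> set xs" by (metis list.set_intros(1) mset_eq_setD)
    then obtain us vs where xs: "xs = us @ y # vs" by (meson split_list)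
    have "R (pre @ us @ y # vs) (pre @ y # us @ vs)"
      using Cons.prems xs by (intro move) simp
    moreover have "R ((pre @ [y]) @ us @ vs) ((pre @ [y]) @ ys)"
      using Cons.prems xs by (intro Cons.IH) simp_all
    ultimately show ?case
      unfolding xs by - (rule trans[of "pre @ us @ y # vs" "pre @ y # us @ vs"], simp_all)
  qed
  from this[of xs ys "[]"] assms(4,5) show ?thesis by simp
qed

text \<open>
  A swap inside a pair is antisymmetry of the commutator; a swap across two adjacent pairs is
  \<open>commutator_exchange\<close>.
\<close>

lemma pair_commutators_swap:
  assumes "even (length (us @ a # b # vs))" "set (us @ a # b # vs) \<subseteq> {1..n}"
  shows "pair_commutators (us @ a # b # vs) + pair_commutators (us @ b # a # vs) \<in> M3 n"
  using assms
proof (induction us rule: pair_commutators.induct)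
  case (1 i j us)
  have "commutator (var i) (var j) * (pair_commutators (us @ a # b # vs) + pair_commutators (us @ b # a # vs)) \<in> M3 n"
    using 1 by (intro M3_left commutator_carrier free_carrier_var) auto
  then show ?case by (simp add: distrib_left)
next
  case "2_1"
  have "commutator (var a) (var b) + commutator (var b) (var a) = 0"
    by (simp add: commutator_def)
  then show ?case by (simp flip: distrib_right)
next
  case ("2_2" u)
  then obtain v ws where vs: "vs = v # ws" by (cases vs) auto
  have "(commutator (var u) (var a) * commutator (var b) (var v)
        + commutator (var u) (var b) * commutator (var a) (var v)) * pair_commutators ws \<in> M3 n"
    using "2_2" vs by (intro M3_right commutator_exchange free_carrier_var pair_commutators_carrier) auto
  then show ?case by (simp add: vs distrib_right mult.assoc)
qed

lemma pair_commutators_perm: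
  assumes "even (length xs)" "set xs \<subseteq> {1..n}" "mset xs = mset ys"
  shows "pair_commutators xs - pair_commutators ys \<in> M3 n \<or> pair_commutators xs + pair_commutators ys \<in> M3 n"
proof -
  define R where "R xs ys \<longleftrightarrow> (\<exists>s\<in>{1, - 1 :: free}. pair_commutators xs - s * pair_commutators ys \<in> M3 n)" for xs ys
  have "R xs ys"
  proof (rule permutation_by_adjacent_swaps[of R "mset xs"])
    show "R xs xs" for xs by (auto simp: R_def)
    show "R xs zs" if R1: "R xs ys" and R2: "R ys zs" for xs ys zs
    proof -
      obtain s where s: "s \<in> {1, - 1 :: free}" "pair_commutators xs - s * pair_commutators ys \<in> M3 n"
        using R1 unfolding R_def by blast
      obtain t where t: "t \<in> {1, - 1 :: free}" "pair_commutators ys - t * pair_commutators zs \<in> M3 n"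
        using R2 unfolding R_def by blast
      have "s \<in> free_carrier n"
        using s(1) free_carrier_uminus[of 1 n] by fastforce
      from M3_add[OF s(2) M3_left[OF this t(2)]] have "pair_commutators xs - (s * t) * pair_commutators zs \<in> M3 n"
        by (simp add: right_diff_distrib mult.assoc)
      moreover have "s * t \<in> {1, - 1}"
        using s(1) t(1) by (elim insertE emptyE) simp_all
      ultimately show ?thesis unfolding R_def by (rule_tac x = "s * t" in bexI)
    qed
    show "R (us @ a # b # vs) (us @ b # a # vs)" if "mset (us @ a # b # vs) = mset xs" for us a b vs
    proof -
      have "length (us @ a # b # vs) = length xs" "set (us @ a # b # vs) = set xs"
        by (rule mset_eq_length[OF that], rule mset_eq_setD[OF that])
      then have "pair_commutators (us @ a # b # vs) + pair_commutators (us @ b # a # vs) \<in> M3 n"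
        using assms(1,2) by (intro pair_commutators_swap) simp_all
      then show ?thesis unfolding R_def by (intro bexI[of _ "- 1"]) simp_all
    qed
  qed (simp_all add: assms(3))
  then obtain s where s: "s \<in> {1, - 1 :: free}" "pair_commutators xs - s * pair_commutators ys \<in> M3 n"
    unfolding R_def by (rule bexE)
  from s(1) consider "s = 1" | "s = - 1"
    by (elim insertE emptyE)
  then show ?thesis
  proof cases
    case 1
    with s(2) show ?thesis by (simp only: mult_1_left simp_thms)
  next
    case 2
    with s(2) show ?thesis by (simp only: mult_minus1 diff_minus_eq_add simp_thms)
  qed
qed

text \<open>
  Permute the two equal letters into the first pair, which gives the factor \<open>[x\<^sub>y, x\<^sub>y] = 0\<close>.  This avoids
  dividing by 2 in \<open>c = - c\<close>.
\<close>

lemma pair_commutators_repeat: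
  assumes "even (length xs)" "set xs \<subseteq> {1..n}" "\<not> distinct xs"
  shows "pair_commutators xs \<in> M3 n"
proof -
  obtain us y vs ws where xs: "xs = us @ [y] @ vs @ [y] @ ws"
    using not_distinct_decomp[OF assms(3)] by blast
  have "pair_commutators (y # y # us @ vs @ ws) = 0"
    by (simp add: commutator_def)
  then show ?thesis
    using pair_commutators_perm[OF assms(1,2), of "y # y # us @ vs @ ws"] xs by simp
qed

text \<open>
  Induction on the number of letters outside the commutators.  Swapping two adjacent letters of the word
  changes the product, modulo \<open>M\<^sub>3\<close>, by a product in which the word is shorter by two letters and the list of
  commutators longer by one pair.  So the word may be sorted, and then the letters in the commutators may be
  sorted as well, up to sign.
\<close>

lemma normal_form_closed:
  assumes "set ws \<subseteq> {1..n}" "set js \<subseteq> {1..n}" "even (length js)"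
  shows "word_poly ws * pair_commutators js - from_form n (to_form (word_poly ws * pair_commutators js)) \<in> M3 n"
  using assms
proof (induction "length ws" arbitrary: ws js rule: less_induct)
  case less
  define S where "S = {p. p - from_form n (to_form p) \<in> M3 n}"
  have S_add: "p + q \<in> S" if "p \<in> S" "q \<in> S" for p q
    using M3_add[of "p - from_form n (to_form p)" n "q - from_form n (to_form q)"] that
    by (simp add: S_def algebra_simps)
  have S_diff: "p - q \<in> S" if "p \<in> S" "q \<in> S" for p q
    using M3_diff[of "p - from_form n (to_form p)" n "q - from_form n (to_form q)"] that
    by (simp add: S_def algebra_simps)
  have S_M3: "p \<in> S" if "p \<in> M3 n" for p
    using that by (simp add: S_def to_form_M3)
  have S_zero: "0 \<in> S" by (simp add: S_def)
  let ?q = "pair_commutators js"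
  let ?R = "\<lambda>us vs. word_poly us * ?q - word_poly vs * ?q \<in> S"
  have qc: "?q \<in> free_carrier n"
    using less.prems by (intro pair_commutators_carrier)
  let ?ws' = "exponent_word n (word_mdeg (Word ws))"
  \<comment> \<open>sorting the word \<open>ws\<close> changes the product by an element of \<open>S\<close>\<close>
  have "?R ws ?ws'"
  proof (rule permutation_by_adjacent_swaps[of ?R "mset ws"])
    show "?R us ws" if "?R us vs" "?R vs ws" for us vs ws
      using S_add[OF that] by simp
    fix us a b vs
    assume m: "mset (us @ a # b # vs) = mset ws"
    have len: "length (us @ a # b # vs) = length ws" and set: "set (us @ a # b # vs) = set ws"
      by (rule mset_eq_length[OF m], rule mset_eq_setD[OF m])
    let ?c = "commutator (var a) (var b)"
    have c: "us \<in> lists {1..n}" "vs \<in> lists {1..n}" "var a \<in> free_carrier n" "var b \<in> free_carrier n"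
      using set less.prems by (auto intro!: free_carrier_var)
    have "word_poly (us @ a # b # vs) * ?q - word_poly (us @ b # a # vs) * ?q
        = word_poly (us @ vs) * pair_commutators (a # b # js)
          - word_poly us * commutator (word_poly vs) ?c * ?q"
      by (simp add: word_poly_append word_poly_Cons commutator_def algebra_simps)
    moreover have "word_poly (us @ vs) * pair_commutators (a # b # js) \<in> S"
      unfolding S_def mem_Collect_eq
      using len set less.prems by (intro less.hyps) auto
    moreover have "word_poly us * commutator (word_poly vs) ?c * ?q \<in> S"
      using c qc by (intro S_M3 M3_right M3_left commutator_central free_carrier_word) auto
    ultimately show "?R (us @ a # b # vs) (us @ b # a # vs)"
      using S_diff by simp
  qed (use less.prems in \<open>simp_all add: S_zero mset_exponent_word\<close>)
  moreover have "word_poly ?ws' * ?q \<in> S"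
  proof (cases "distinct js")
    case False
    then show ?thesis
      using less.prems pair_commutators_repeat[of js n]
      by (intro S_M3 M3_left free_carrier_word set_exponent_word) auto
  next
    case True
    let ?J = "set js" and ?js' = "sorted_list_of_set (set js)"
    have "mset js = mset ?js'"
      using True by (subst set_eq_iff_mset_eq_distinct[symmetric]) simp_all
    then have perm: "?q - pair_commutators ?js' \<in> M3 n \<or> ?q + pair_commutators ?js' \<in> M3 n"
      using less.prems by (intro pair_commutators_perm)
    have "word_poly ?ws' * pair_commutators ?js' \<in> S"
    proof -
      have "Poly_Mapping.keys (word_mdeg (Word ws)) \<subseteq> {1..n}"
        using less.prems by (auto simp: in_keys_iff lookup_word_mdeg)
      then have "mono_form ?J (word_mdeg (Word ws)) 1 \<in> even_forms n"
        using less.prems True by (intro forms_in_mono_form) (auto simp: distinct_card)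
      moreover have "from_form n (mono_form ?J (word_mdeg (Word ws)) 1) = word_poly ?ws' * pair_commutators ?js'"
        by (simp add: from_form_mono)
      ultimately show ?thesis
        unfolding S_def mem_Collect_eq using to_form_from_form[of "mono_form ?J (word_mdeg (Word ws)) 1" n]
        by simp
    qed
    moreover from perm have "word_poly ?ws' * (?q - pair_commutators ?js') \<in> S \<or> word_poly ?ws' * (?q + pair_commutators ?js') \<in> S"
      using S_M3[OF M3_left[OF free_carrier_word[OF set_exponent_word]]] by blast
    ultimately show ?thesis
    proof (elim disjE)
      assume "word_poly ?ws' * pair_commutators ?js' \<in> S" "word_poly ?ws' * (?q - pair_commutators ?js') \<in> S"
      from S_add[OF this] show ?thesis by (simp add: right_diff_distrib)
    next
      assume "word_poly ?ws' * pair_commutators ?js' \<in> S" "word_poly ?ws' * (?q + pair_commutators ?js') \<in> S"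
      from S_diff[OF this(2,1)] show ?thesis by (simp add: distrib_left)
    qed
  qed
  ultimately have "(word_poly ws * ?q - word_poly ?ws' * ?q) + word_poly ?ws' * ?q \<in> S"
    by (rule S_add)
  then have "word_poly ws * ?q \<in> S" by (simp only: diff_add_cancel)
  then show ?case by (simp only: S_def mem_Collect_eq)
qed

text \<open>
  By additivity the case of a word without commutators suffices.
\<close>

lemma from_form_to_form:
  assumes "p \<in> free_carrier n"
  shows "p - from_form n (to_form p) \<in> M3 n"
  using assms
proof (induction rule: free_carrier_word_induct)
  case (add p q)
  then show ?case
    using M3_add[of "p - from_form n (to_form p)" n "q - from_form n (to_form q)"]
    by (simp add: algebra_simps)
next
  case (word ws c)
  have w: "word_poly ws - from_form n (to_form (word_poly ws)) \<in> M3 n"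
    using normal_form_closed[of ws n "[]"] word by simp
  have "of_nat k * word_poly ws - from_form n (to_form (of_nat k * word_poly ws)) \<in> M3 n" for k
  proof (induction k)
    case (Suc k)
    from M3_add[OF w Suc] show ?case by (simp add: algebra_simps)
  qed simp
  note nat_multiple = this
  obtain k l where c: "c = int k - int l"
    by (rule int_diff_cases)
  have "of_int c * word_poly ws = of_nat k * word_poly ws - of_nat l * word_poly ws"
    unfolding c by (simp add: left_diff_distrib)
  moreover have "p - q - from_form n (to_form (p - q)) = (p - from_form n (to_form p)) - (q - from_form n (to_form q))" for p q
    by simp
  ultimately show ?case
    using M3_diff[OF nat_multiple[of k] nat_multiple[of l]] by (simp only:)
qed simp

lemma to_form_kernel:
  "p \<in> free_carrier n \<Longrightarrow> to_form p = 0 \<Longrightarrow> p \<in> M3 n"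
  using from_form_to_form[of p n] by simp


section \<open>Quotients of additive groups\<close>

lemma additive_coset_eq:
  fixes x :: "'a::ab_group_add"
  assumes "monoid.mult G = (+)"
  shows "H #>\<^bsub>G\<^esub> x = {y. y - x \<in> H}"
  unfolding r_coset_def assms by (auto intro: exI[of _ "_ - x"] simp: algebra_simps)

lemma additive_coset_add:
  fixes x :: "'a::ab_group_add"
  assumes "monoid.mult G = (+)" "0 \<in> H" "\<And>x y. x \<in> H \<Longrightarrow> y \<in> H \<Longrightarrow> x + y \<in> H"
  shows "{y. y - x \<in> H} <#>\<^bsub>G\<^esub> {y. y - x' \<in> H} = {y. y - (x + x') \<in> H}"
proof (intro equalityI subsetI)
  fix z
  assume "z \<in> {y. y - x \<in> H} <#>\<^bsub>G\<^esub> {y. y - x' \<in> H}"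
  then obtain y y' where "z = y + y'" "y - x \<in> H" "y' - x' \<in> H"
    by (auto simp: set_mult_def assms(1))
  then show "z \<in> {y. y - (x + x') \<in> H}"
    using assms(3)[of "y - x" "y' - x'"] by (simp add: algebra_simps)
next
  fix z
  assume "z \<in> {y. y - (x + x') \<in> H}"
  then have "z - x' - x \<in> H" "x' - x' \<in> H" "z = (z - x') + x'"
    using assms(2) by (simp_all add: algebra_simps)
  then show "z \<in> {y. y - x \<in> H} <#>\<^bsub>G\<^esub> {y. y - x' \<in> H}"
    unfolding set_mult_def assms(1) by blast
qed

lemma coset_eq_iff:
  fixes x :: "'a::ab_group_add"
  assumes "0 \<in> H" "\<And>x y. x \<in> H \<Longrightarrow> y \<in> H \<Longrightarrow> x + y \<in> H" "\<And>x. x \<in> H \<Longrightarrow> - x \<in> H"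
  shows "{y. y - x \<in> H} = {y. y - x' \<in> H} \<longleftrightarrow> x - x' \<in> H"
proof
  assume "{y. y - x \<in> H} = {y. y - x' \<in> H}"
  moreover have "x \<in> {y. y - x \<in> H}" using assms(1) by simp
  ultimately show "x - x' \<in> H" by blast
next
  assume d: "x - x' \<in> H"
  show "{y. y - x \<in> H} = {y. y - x' \<in> H}"
  proof (intro equalityI subsetI CollectI)
    fix y assume "y \<in> {y. y - x \<in> H}"
    then show "y - x' \<in> H" using assms(2)[of "y - x" "x - x'"] d by simp
  next
    fix y assume "y \<in> {y. y - x' \<in> H}"
    then show "y - x \<in> H" using assms(2)[of "y - x'" "- (x - x')"] assms(3)[OF d] by simp
  qed
qed


section \<open>De Rham cohomology groups\<close>

lemma closed_forms_eq: "closed_forms n i = {\<omega> \<in> forms_in n {i}. deRham n \<omega> = 0}"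
  by (simp add: closed_forms_def forms_eq)

lemma comm_group_closed_forms: "comm_group (closed_forms_group n i)"
proof (rule comm_groupI)
  fix \<omega>
  assume "\<omega> \<in> carrier (closed_forms_group n i)"
  then show "\<exists>\<eta>\<in>carrier (closed_forms_group n i).
      \<eta> \<otimes>\<^bsub>closed_forms_group n i\<^esub> \<omega> = \<one>\<^bsub>closed_forms_group n i\<^esub>"
    by (intro bexI[of _ "- \<omega>"]) (auto simp: closed_forms_group_def closed_forms_eq forms_in_uminus)
qed (auto simp: closed_forms_group_def closed_forms_eq forms_in_add add_ac)

lemma exact_forms_zero: "0 \<in> exact_forms n i"
  by (auto simp: exact_forms_def forms_eq intro!: image_eqI[of _ _ 0])

lemma exact_forms_add: "\<omega> \<in> exact_forms n i \<Longrightarrow> \<eta> \<in> exact_forms n i \<Longrightarrow> \<omega> + \<eta> \<in> exact_forms n i"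
  by (auto simp: exact_forms_def forms_eq simp flip: deRham_add split: if_splits intro!: imageI forms_in_add)

lemma exact_forms_uminus: "\<omega> \<in> exact_forms n i \<Longrightarrow> - \<omega> \<in> exact_forms n i"
  by (auto simp: exact_forms_def forms_eq simp flip: deRham_minus split: if_splits intro!: imageI forms_in_uminus)

lemma exact_forms_closed: "exact_forms n i \<subseteq> closed_forms n i"
proof (cases i)
  case (Suc k)
  then show ?thesis
    by (auto simp: exact_forms_def forms_eq closed_forms_eq intro: deRham_in)
qed (simp add: exact_forms_def closed_forms_eq)

lemma exact_forms_normal: "exact_forms n i \<lhd> closed_forms_group n i"
proof -
  interpret comm_group "closed_forms_group n i" by (rule comm_group_closed_forms)
  have "subgroup (exact_forms n i) (closed_forms_group n i)"
  proof (rule subgroupI)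
    show "exact_forms n i \<subseteq> carrier (closed_forms_group n i)"
      using exact_forms_closed by (simp add: closed_forms_group_def)
    show "exact_forms n i \<noteq> {}" using exact_forms_zero by blast
    fix \<omega>
    assume \<omega>: "\<omega> \<in> exact_forms n i"
    then have "\<omega> \<in> closed_forms n i" using exact_forms_closed by blast
    then have "inv\<^bsub>closed_forms_group n i\<^esub> \<omega> = - \<omega>"
      by (intro inv_equality) (auto simp: closed_forms_group_def closed_forms_eq forms_in_uminus)
    then show "inv\<^bsub>closed_forms_group n i\<^esub> \<omega> \<in> exact_forms n i"
      using \<omega> by (simp add: exact_forms_uminus)
  qed (simp add: closed_forms_group_def exact_forms_add)
  then show ?thesis by (rule subgroup_imp_normal)
qed

lemma group_deRham_cohomology: "group (deRham_cohomology n i)"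
  unfolding deRham_cohomology_def by (rule normal.factorgroup_is_group[OF exact_forms_normal])

definition cohomology_class :: "nat \<Rightarrow> nat \<Rightarrow> form \<Rightarrow> form set" where
  "cohomology_class n i \<omega> = {\<eta>. \<eta> - \<omega> \<in> exact_forms n i}"

lemma cohomology_class_coset: "exact_forms n i #>\<^bsub>closed_forms_group n i\<^esub> \<omega> = cohomology_class n i \<omega>"
  unfolding cohomology_class_def by (rule additive_coset_eq) (simp add: closed_forms_group_def)

lemma carrier_deRham_cohomology: "carrier (deRham_cohomology n i) = cohomology_class n i ` closed_forms n i"
  unfolding deRham_cohomology_def FactGroup_def RCOSETS_def cohomology_class_coset
  by (auto simp: closed_forms_group_def)

lemma cohomology_class_mult:
  "cohomology_class n i \<omega> \<otimes>\<^bsub>deRham_cohomology n i\<^esub> cohomology_class n i \<eta> = cohomology_class n i (\<omega> + \<eta>)"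
  unfolding deRham_cohomology_def FactGroup_def cohomology_class_def
  by simp (rule additive_coset_add, simp_all add: closed_forms_group_def exact_forms_zero exact_forms_add)

lemma cohomology_class_eq_iff:
  "cohomology_class n i \<omega> = cohomology_class n i \<eta> \<longleftrightarrow> \<omega> - \<eta> \<in> exact_forms n i"
  unfolding cohomology_class_def
  by (rule coset_eq_iff) (simp_all add: exact_forms_zero exact_forms_add exact_forms_uminus)

lemma carrier_H_ev_plus:
  "carrier (H_ev_plus n) = (\<Pi>\<^sub>E k\<in>{1..n div 2}. cohomology_class n (2 * k) ` closed_forms n (2 * k))"
  unfolding H_ev_plus_def
  by (subst carrier_sum_group) (auto simp: group_deRham_cohomology carrier_deRham_cohomology)

lemma mult_H_ev_plus:
  "x \<otimes>\<^bsub>H_ev_plus n\<^esub> y = (\<lambda>k\<in>{1..n div 2}. x k \<otimes>\<^bsub>deRham_cohomology n (2 * k)\<^esub> y k)"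
  by (simp add: H_ev_plus_def)

lemma cohomology_component_eq:
  "cohomology_component n i m = cohomology_class n i ` (closed_forms n i \<inter> form_component m)"
  by (simp add: cohomology_component_def cohomology_class_coset)


section \<open>The quotient of the free ring\<close>

abbreviation ker :: "nat \<Rightarrow> free set" where "ker n \<equiv> B1bar_kernel (free_ring n)"

text \<open>
  For a monomial of odd degree, pick some \<open>dx\<^sub>i\<close> occurring in it and write it as \<open>dx\<^sub>i \<and> \<omega>\<close>.  Then its
  differential \<open>- dx\<^sub>i \<and> d\<omega>\<close> is the image of \<open>[p, x\<^sub>i]\<close> for any \<open>p\<close> with image \<open>\<omega>\<close>.
\<close>

lemma odd_form_exact_in_image:
  assumes "\<eta> \<in> odd_forms n"
  shows "\<exists>q\<in>L2 n. to_form q = deRham n \<eta>"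
  using assms
proof (induction rule: forms_in_induct)
  case zero
  then show ?case
    by (intro bexI[of _ 0]) (simp, simp only: L2_eq span_zero)
next
  case (add \<omega> \<eta>)
  then obtain p q where "p \<in> L2 n" "q \<in> L2 n" "to_form p = deRham n \<omega>" "to_form q = deRham n \<eta>"
    by blast
  then show ?case
    by (intro bexI[of _ "p + q"]) (simp_all only: L2_eq span_add to_form_add deRham_add)
next
  case (mono J a c)
  then have "J \<noteq> {}" by auto
  then obtain i where i: "i \<in> J" by blast
  define \<omega> where "\<omega> = contract i (mono_form J a c)"
  have \<omega>: "\<omega> \<in> even_forms n"
    unfolding \<omega>_def using mono by (intro contract_in[where D = "{k. odd k}"] forms_in_mono_form) auto
  have i': "i \<in> {1..n}" using i mono by blast
  let ?p = "from_form n \<omega>"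
  have p: "?p \<in> free_carrier n" by (rule from_form_carrier[OF \<omega>])
  have "to_form (commutator ?p (var i)) = - to_form (var i * ?p - ?p * var i)"
    unfolding commutator_def to_form_minus[symmetric] by simp
  also have "\<dots> = - wedge i (deRham n \<omega>)"
    unfolding to_form_commutator[OF p i'] to_form_from_form[OF \<omega>] ..
  also have "\<dots> = deRham n (wedge i \<omega>)"
    by (simp add: deRham_wedge)
  also have "wedge i \<omega> = mono_form J a c"
    using i by (simp add: \<omega>_def wedge_contract_mono)
  finally show ?case
    using commutator_L2[OF p free_carrier_var[OF i']] by blast
qed

lemma ker_eq: "ker n = {l + q | l q. l \<in> L2 n \<and> q \<in> M3 n}"
  by (auto simp: B1bar_kernel_def set_add_def' )

lemma ker_carrier: "ker n \<subseteq> free_carrier n"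
  unfolding ker_eq using L2_carrier M3_carrier by (auto intro!: free_carrier_add)

text \<open>
  Together with the surjectivity of \<open>to_form\<close> onto the even forms this identifies the quotient of the free ring
  with the even forms modulo exact ones.
\<close>

lemma ker_iff:
  assumes "p \<in> free_carrier n"
  shows "p \<in> ker n \<longleftrightarrow> to_form p \<in> deRham n ` odd_forms n"
proof
  assume "p \<in> ker n"
  then obtain l q where "p = l + q" "l \<in> L2 n" "q \<in> M3 n" unfolding ker_eq by blast
  then show "to_form p \<in> deRham n ` odd_forms n"
    using to_form_L2[of l n] to_form_M3[of q n] by simp
next
  assume "to_form p \<in> deRham n ` odd_forms n"
  then obtain l where l: "l \<in> L2 n" "to_form l = to_form p"
    using odd_form_exact_in_image by fastforce
  have "p - l \<in> M3 n"
    using assms l L2_carrier by (intro to_form_kernel free_carrier_diff) auto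
  moreover have "p = l + (p - l)" by simp
  ultimately show "p \<in> ker n"
    unfolding ker_eq using l(1) by blast
qed

lemma ker_zero: "0 \<in> ker n"
  by (simp add: ker_iff) (rule image_eqI[of _ _ 0], simp_all)

lemma ker_add: "p \<in> ker n \<Longrightarrow> q \<in> ker n \<Longrightarrow> p + q \<in> ker n"
proof -
  assume "p \<in> ker n" "q \<in> ker n"
  moreover from this have c: "p \<in> free_carrier n" "q \<in> free_carrier n" using ker_carrier by auto
  ultimately obtain \<omega> \<eta> where "\<omega> \<in> odd_forms n" "\<eta> \<in> odd_forms n" "to_form p = deRham n \<omega>" "to_form q = deRham n \<eta>"
    by (auto simp: ker_iff)
  then show ?thesis
    using c by (auto simp: ker_iff free_carrier_add intro!: image_eqI[of _ _ "\<omega> + \<eta>"] forms_in_add)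
qed

lemma ker_uminus: "p \<in> ker n \<Longrightarrow> - p \<in> ker n"
proof -
  assume "p \<in> ker n"
  moreover from this have c: "p \<in> free_carrier n" using ker_carrier by auto
  ultimately obtain \<omega> where "\<omega> \<in> odd_forms n" "to_form p = deRham n \<omega>"
    by (auto simp: ker_iff)
  then show ?thesis
    using c by (auto simp: ker_iff free_carrier_uminus intro!: image_eqI[of _ _ "- \<omega>"] forms_in_uminus)
qed

lemma ker_normal: "ker n \<lhd> add_monoid (free_ring n)"
proof -
  interpret comm_group "add_monoid (free_ring n)"
    by (rule abelian_group.a_comm_group[OF abelian_group_free_ring])
  have "subgroup (ker n) (add_monoid (free_ring n))"
  proof (rule subgroupI)
    show "ker n \<subseteq> carrier (add_monoid (free_ring n))" using ker_carrier by simp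
    show "ker n \<noteq> {}" using ker_zero by blast
    fix p assume p: "p \<in> ker n"
    then have "inv\<^bsub>add_monoid (free_ring n)\<^esub> p = - p"
      using a_inv_free_ring[of p n] ker_carrier unfolding a_inv_def by blast
    then show "inv\<^bsub>add_monoid (free_ring n)\<^esub> p \<in> ker n"
      using ker_uminus[OF p] by (simp only:)
  qed (simp add: ker_add)
  then show ?thesis by (rule subgroup_imp_normal)
qed

abbreviation (input) B :: "nat \<Rightarrow> free set monoid" where "B n \<equiv> B1bar (free_ring n)"

definition residue :: "nat \<Rightarrow> free \<Rightarrow> free set" where
  "residue n p = {q. q - p \<in> ker n}"

lemma residue_coset: "ker n #>\<^bsub>add_monoid (free_ring n)\<^esub> p = residue n p"
  unfolding residue_def by (rule additive_coset_eq) simp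

lemma group_B: "group (B n)"
  unfolding B1bar_def by (rule normal.factorgroup_is_group[OF ker_normal])

lemma carrier_B: "carrier (B n) = residue n ` free_carrier n"
  unfolding B1bar_def FactGroup_def RCOSETS_def residue_coset by auto

lemma mult_B: "residue n p \<otimes>\<^bsub>B n\<^esub> residue n q = residue n (p + q)"
  unfolding B1bar_def FactGroup_def residue_def
  by simp (rule additive_coset_add, simp_all add: ker_zero ker_add)

lemma one_B: "\<one>\<^bsub>B n\<^esub> = residue n 0"
  by (simp add: B1bar_def FactGroup_def residue_def)

lemma pow_B: "residue n p [^]\<^bsub>B n\<^esub> (k::nat) = residue n (\<Sum>_<k. p)"
proof (induction k)
  case 0
  show ?case using group.is_monoid[OF group_B, THEN monoid.nat_pow_0] by (simp add: one_B)
next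
  case (Suc k)
  then show ?case
    using group.is_monoid[OF group_B, THEN monoid.nat_pow_Suc] by (simp only: mult_B sum.lessThan_Suc)
qed

lemma residue_eq_iff: "residue n p = residue n q \<longleftrightarrow> p - q \<in> ker n"
  unfolding residue_def by (rule coset_eq_iff) (simp_all add: ker_zero ker_add ker_uminus)

text \<open>
  Multiples of a residue class vanish iff the corresponding multiples of the form are exact, so this is
  the description of torsion by the Euler homotopy.
\<close>

lemma residue_torsion_iff:
  assumes "p \<in> free_carrier n"
  shows "residue n p \<in> torsion (B n) \<longleftrightarrow> deRham n (to_form p) = 0 \<and> degree_part 0 (to_form p) = 0"
proof -
  have c: "(\<Sum>_<k. p) \<in> free_carrier n" for k :: nat
    by (induction k) (simp_all only: lessThan_0 sum.empty sum.lessThan_Suc free_carrier_zero free_carrier_add assms)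
  have "residue n p [^]\<^bsub>B n\<^esub> k = \<one>\<^bsub>B n\<^esub> \<longleftrightarrow> (\<Sum>_<k. to_form p) \<in> deRham n ` odd_forms n" for k :: nat
    unfolding pow_B one_B residue_eq_iff diff_zero ker_iff[OF c] to_form_sum ..
  moreover have "residue n p \<in> carrier (B n)" using assms by (simp add: carrier_B)
  ultimately have "residue n p \<in> torsion (B n) \<longleftrightarrow> (\<exists>k::nat>0. (\<Sum>_<k. to_form p) \<in> deRham n ` odd_forms n)"
    by (simp only: torsion_def mem_Collect_eq simp_thms)
  then show ?thesis
    using closed_multiple_exact[OF to_form_even[OF assms]]
      multiple_exact_closed[where \<omega> = "to_form p" and n = n] by blast
qed

lemma torsion_B:
  "torsion (B n) = residue n ` {p \<in> free_carrier n. deRham n (to_form p) = 0 \<and> degree_part 0 (to_form p) = 0}"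
proof (intro equalityI subsetI)
  fix C assume C: "C \<in> torsion (B n)"
  then obtain p where "p \<in> free_carrier n" "C = residue n p"
    unfolding torsion_def by (auto simp: carrier_B)
  with C show "C \<in> residue n ` {p \<in> free_carrier n. deRham n (to_form p) = 0 \<and> degree_part 0 (to_form p) = 0}"
    using residue_torsion_iff by blast
qed (use residue_torsion_iff in blast)


section \<open>Multidegrees\<close>

definition homogeneous :: "(nat \<Rightarrow>\<^sub>0 nat) \<Rightarrow> free \<Rightarrow> bool" where
  "homogeneous m p \<longleftrightarrow> (\<forall>w \<in> Poly_Mapping.keys p. word_mdeg w = m)"

lemma free_ring_component_eq: "free_ring_component n m = {p \<in> free_carrier n. homogeneous m p}"
  by (simp add: free_ring_component_def homogeneous_def)

lemma homogeneous_zero [simp]: "homogeneous m 0"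
  by (simp add: homogeneous_def)

lemma homogeneous_add: "homogeneous m p \<Longrightarrow> homogeneous m q \<Longrightarrow> homogeneous m (p + q)"
  using Poly_Mapping.keys_add[of p q] by (auto simp: homogeneous_def)

lemma homogeneous_diff: "homogeneous m p \<Longrightarrow> homogeneous m q \<Longrightarrow> homogeneous m (p - q)"
  using keys_diff[of p q] by (auto simp: homogeneous_def)

lemma word_mdeg_plus: "word_mdeg (u + v) = word_mdeg u + word_mdeg v"
  by (simp add: word_mdeg_def plus_word_def)

lemma homogeneous_mult: "homogeneous m p \<Longrightarrow> homogeneous m' q \<Longrightarrow> homogeneous (m + m') (p * q)"
  using keys_mult[of p q] by (fastforce simp: homogeneous_def word_mdeg_plus)

lemma homogeneous_word_poly: "homogeneous (word_mdeg (Word ws)) (word_poly ws)"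
  by (simp add: homogeneous_def word_poly_def)

lemma homogeneous_var: "homogeneous (Poly_Mapping.single i 1) (var i)"
  by (simp add: homogeneous_def var_def word_mdeg_def)

lemma homogeneous_of_int: "homogeneous 0 (of_int c)"
proof -
  have one: "homogeneous 0 1"
    using homogeneous_word_poly[of "[]"] by (simp add: word_mdeg_Nil)
  have "homogeneous 0 (of_nat k)" for k
    by (induction k) (simp_all add: homogeneous_add one)
  then show ?thesis
    by (cases c rule: int_diff_cases) (simp add: homogeneous_diff)
qed

lemma homogeneous_pair_commutators:
  "even (length js) \<Longrightarrow> homogeneous (word_mdeg (Word js)) (pair_commutators js)"
proof (induction js rule: pair_commutators.induct)
  case (1 i j ks)
  have "homogeneous (Poly_Mapping.single i 1 + Poly_Mapping.single j 1) (commutator (var i) (var j))"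
    using homogeneous_mult[OF homogeneous_var[of i] homogeneous_var[of j]]
      homogeneous_mult[OF homogeneous_var[of j] homogeneous_var[of i]]
    unfolding commutator_def by (intro homogeneous_diff) (simp_all add: add.commute)
  from homogeneous_mult[OF this 1(1)] 1(2) show ?case
    by (simp add: word_mdeg_Cons add.assoc)
qed (use homogeneous_of_int[of 1] in \<open>simp_all add: word_mdeg_Nil\<close>)

lemma word_mdeg_sorted_list: "finite J \<Longrightarrow> word_mdeg (Word (sorted_list_of_set J)) = (\<Sum>j\<in>J. Poly_Mapping.single j 1)"
  by (simp add: word_mdeg_def sum_list_distinct_conv_sum_set)

lemma from_form_component:
  assumes "\<omega> \<in> even_forms n" "\<omega> \<in> form_component m"
  shows "from_form n \<omega> \<in> free_ring_component n m"
proof -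
  have "homogeneous m (from_form n \<omega>)"
    using assms
  proof (induction rule: graded_induct)
    case (mono J a c)
    have "homogeneous (0 + (word_mdeg (Word (exponent_word n a)) + word_mdeg (Word (sorted_list_of_set J))))
        (from_form n (mono_form J a c))"
      unfolding from_form_mono using mono
      by (intro homogeneous_mult homogeneous_of_int homogeneous_word_poly homogeneous_pair_commutators) simp
    then show ?case
      using mono by (simp add: word_mdeg_exponent_word word_mdeg_sorted_list)
  qed (simp_all add: homogeneous_add)
  with from_form_carrier[OF assms(1)] show ?thesis
    by (simp add: free_ring_component_eq)
qed

lemma to_form_word_component:
  assumes "set ws \<subseteq> {1..n}"
  shows "foldr left_mul ws (mono_form {} 0 c) \<in> even_forms n \<inter> form_component (word_mdeg (Word ws))"
  using assms
proof (induction ws)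
  case Nil
  show ?case
    by (auto simp: word_mdeg_Nil intro: forms_in_mono_form form_component_mono_form)
next
  case (Cons i ws)
  then show ?case
    using left_mul_component[of "foldr left_mul ws (mono_form {} 0 c)" n "word_mdeg (Word ws)" i]
    by (simp add: left_mul_in_even word_mdeg_Cons add.commute)
qed

lemma to_form_component:
  assumes "p \<in> free_ring_component n m"
  shows "to_form p \<in> form_component m"
proof (induction p rule: poly_mapping_span_induct)
  case (single w)
  with assms have "set (letters w) \<subseteq> {1..n}" "word_mdeg w = m"
    by (auto simp: free_ring_component_def free_carrier_iff)
  then show ?case
    using to_form_word_component[of "letters w" n] by (auto simp: to_form_single)
qed (simp_all add: form_component_add)

lemma B1bar_component_eq: "B1bar_component n m = residue n ` free_ring_component n m"
  unfolding B1bar_component_def a_r_coset_def residue_coset ..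

lemma degree_part_component: "\<omega> \<in> form_component m \<Longrightarrow> degree_part k \<omega> \<in> form_component m"
  unfolding form_component_eq degree_part_def by (simp add: supported_reweight)


section \<open>The isomorphism\<close>

definition class_family :: "nat \<Rightarrow> form \<Rightarrow> nat \<Rightarrow> form set" where
  "class_family n \<omega> = (\<lambda>k\<in>{1..n div 2}. cohomology_class n (2 * k) (degree_part (2 * k) \<omega>))"

text \<open>
  A representative in the free ring has to be chosen; \<open>torsion_iso_residue\<close> shows that the choice does
  not affect the value.
\<close>

definition torsion_iso :: "nat \<Rightarrow> free set \<Rightarrow> nat \<Rightarrow> form set" where
  "torsion_iso n C = class_family n (to_form (SOME p. p \<in> free_carrier n \<and> p \<in> C))"

text \<open>
  Exactness is tested degree by degree.  Degree 0 is excluded by hypothesis and degrees above \<open>n\<close>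
  contain no forms, so the finitely many degrees in \<open>class_family\<close> suffice.
\<close>

lemma class_family_eq_iff:
  assumes "\<omega> \<in> even_forms n" "\<eta> \<in> even_forms n" "degree_part 0 \<omega> = 0" "degree_part 0 \<eta> = 0"
  shows "class_family n \<omega> = class_family n \<eta> \<longleftrightarrow> \<omega> - \<eta> \<in> deRham n ` odd_forms n"
proof -
  have high: "degree_part (2 * k) (\<omega> - \<eta>) = 0" if "k \<notin> {1..n div 2}" for k
  proof (cases "k = 0")
    case False
    with that have "n < 2 * k" by auto
    have "coeff (degree_part (2 * k) (\<omega> - \<eta>)) J a = 0" for J a
    proof -
      have "card J \<le> n" if "coeff (\<omega> - \<eta>) J a \<noteq> 0"
        using that forms_in_diff[OF assms(1,2)] card_mono[of "{1..n}" J]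
        by (auto simp: forms_in_def supported_def)
      with \<open>n < 2 * k\<close> show ?thesis
        by (cases "coeff (\<omega> - \<eta>) J a = 0") (auto simp: degree_part_def coeff_reweight)
    qed
    then show ?thesis by (intro form_eqI) simp
  qed (simp add: assms(3,4))
  have "class_family n \<omega> = class_family n \<eta> \<longleftrightarrow>
      (\<forall>k\<in>{1..n div 2}. degree_part (2 * k) (\<omega> - \<eta>) \<in> exact_forms n (2 * k))"
    unfolding class_family_def restrict_def fun_eq_iff degree_part_diff
    by (auto simp: cohomology_class_eq_iff)
  also have "\<dots> \<longleftrightarrow> (\<forall>k. degree_part (2 * k) (\<omega> - \<eta>) \<in> exact_forms n (2 * k))"
    using high exact_forms_zero by metis
  also have "\<dots> \<longleftrightarrow> \<omega> - \<eta> \<in> deRham n ` odd_forms n"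
    by (rule exact_iff_degree_parts[symmetric, OF forms_in_diff[OF assms(1,2)]])
  finally show ?thesis .
qed

abbreviation torsion_reps :: "nat \<Rightarrow> free set" where
  "torsion_reps n \<equiv> {p \<in> free_carrier n. deRham n (to_form p) = 0 \<and> degree_part 0 (to_form p) = 0}"

lemma class_family_to_form_eq_iff:
  assumes "p \<in> torsion_reps n" "q \<in> torsion_reps n"
  shows "class_family n (to_form p) = class_family n (to_form q) \<longleftrightarrow> residue n p = residue n q"
  using assms class_family_eq_iff[of "to_form p" n "to_form q"] ker_iff[of "p - q" n]
  by (simp add: residue_eq_iff to_form_even free_carrier_diff)

lemma torsion_iso_residue:
  assumes "p \<in> torsion_reps n"
  shows "torsion_iso n (residue n p) = class_family n (to_form p)"
proof -
  define q where "q = (SOME q. q \<in> free_carrier n \<and> q \<in> residue n p)"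
  have "p \<in> free_carrier n \<and> p \<in> residue n p"
    using assms ker_zero by (simp add: residue_def)
  then have q: "q \<in> free_carrier n \<and> q \<in> residue n p"
    unfolding q_def by (rule someI)
  then have eq: "residue n q = residue n p"
    by (simp add: residue_eq_iff) (simp add: residue_def)
  have "residue n p \<in> torsion (B n)"
    using assms residue_torsion_iff by blast
  then have "q \<in> torsion_reps n"
    using q eq residue_torsion_iff[of q n] by simp
  then show ?thesis
    using class_family_to_form_eq_iff[OF _ assms] eq by (simp add: torsion_iso_def q_def)
qed

lemma degree_part_closed:
  assumes "p \<in> torsion_reps n"
  shows "degree_part i (to_form p) \<in> closed_forms n i"
proof -
  have even: "to_form p \<in> even_forms n" using assms by (simp add: to_form_even)
  then have "deRham n (degree_part i (to_form p)) = 0"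
    using degree_part_deRham(2)[OF even, of i] assms by simp
  with degree_part_in[OF even] show ?thesis by (simp add: closed_forms_eq)
qed

lemma class_family_add:
  "class_family n (\<omega> + \<eta>) = class_family n \<omega> \<otimes>\<^bsub>H_ev_plus n\<^esub> class_family n \<eta>"
  unfolding class_family_def[of n "\<omega> + \<eta>"] mult_H_ev_plus
  by (rule restrict_ext) (simp add: class_family_def cohomology_class_mult)

lemma class_family_in_carrier:
  "p \<in> torsion_reps n \<Longrightarrow> class_family n (to_form p) \<in> carrier (H_ev_plus n)"
  using degree_part_closed[of p n] by (auto simp: carrier_H_ev_plus class_family_def)

text \<open>
  Surjectivity, with an explicit preimage: this preimage inherits the multidegree of the forms \<open>\<omega> k\<close>.
\<close>

lemma class_family_realised:
  assumes closed: "\<forall>k\<in>{1..n div 2}. \<omega> k \<in> closed_forms n (2 * k)"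
  defines "p \<equiv> from_form n (\<Sum>k\<in>{1..n div 2}. \<omega> k)"
  shows "p \<in> torsion_reps n"
    and "class_family n (to_form p) = (\<lambda>k\<in>{1..n div 2}. cohomology_class n (2 * k) (\<omega> k))"
proof -
  let ?I = "{1..n div 2}"
  have \<omega>: "\<omega> k \<in> forms_in n {2 * k}" "deRham n (\<omega> k) = 0" if "k \<in> ?I" for k
    using closed that by (simp_all add: closed_forms_eq)
  have even: "sum \<omega> ?I \<in> even_forms n"
  proof (rule forms_in_sum)
    fix k assume "k \<in> ?I"
    moreover have "forms_in n {2 * k} \<subseteq> even_forms n" by (rule forms_in_subset) auto
    ultimately show "\<omega> k \<in> even_forms n" using \<omega>(1) by blast
  qed
  have to_form: "to_form p = sum \<omega> ?I"
    unfolding p_def by (rule to_form_from_form[OF even])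
  have part: "degree_part j (to_form p) = (\<Sum>k\<in>?I. if j = 2 * k then \<omega> k else 0)" for j
    unfolding to_form degree_part_sum by (intro sum.cong refl degree_part_eq[where n = n] \<omega>(1))
  have "degree_part 0 (to_form p) = 0"
    unfolding part by (intro sum.neutral) auto
  moreover have "deRham n (to_form p) = 0"
    unfolding to_form deRham_sum by (intro sum.neutral) (simp add: \<omega>(2))
  moreover have "p \<in> free_carrier n"
    unfolding p_def by (rule from_form_carrier[OF even])
  ultimately show "p \<in> torsion_reps n" by simp
  show "class_family n (to_form p) = (\<lambda>k\<in>?I. cohomology_class n (2 * k) (\<omega> k))"
    unfolding class_family_def part by (intro restrict_ext) simp
qed

lemma torsion_iso_iso: "torsion_iso n \<in> iso (torsion_group (B n)) (H_ev_plus n)"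
  unfolding iso_def
proof (intro CollectI conjI homI)
  fix C assume "C \<in> carrier (torsion_group (B n))"
  then show "torsion_iso n C \<in> carrier (H_ev_plus n)"
    by (auto simp: torsion_group_def torsion_B torsion_iso_residue class_family_in_carrier)
next
  fix C D assume "C \<in> carrier (torsion_group (B n))" "D \<in> carrier (torsion_group (B n))"
  then obtain p q where pq: "p \<in> torsion_reps n" "q \<in> torsion_reps n" "C = residue n p" "D = residue n q"
    by (auto simp: torsion_group_def torsion_B)
  then have "p + q \<in> torsion_reps n" by (simp add: free_carrier_add)
  moreover have "C \<otimes>\<^bsub>torsion_group (B n)\<^esub> D = residue n (p + q)"
    by (simp add: torsion_group_def pq mult_B)
  ultimately show "torsion_iso n (C \<otimes>\<^bsub>torsion_group (B n)\<^esub> D) = torsion_iso n C \<otimes>\<^bsub>H_ev_plus n\<^esub> torsion_iso n D"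
    using pq(1,2) by (simp only: pq(3,4) torsion_iso_residue to_form_add class_family_add)
next
  show "bij_betw (torsion_iso n) (carrier (torsion_group (B n))) (carrier (H_ev_plus n))"
  proof (rule bij_betw_imageI)
    show "inj_on (torsion_iso n) (carrier (torsion_group (B n)))"
    proof (rule inj_onI)
      fix C D assume CD: "C \<in> carrier (torsion_group (B n))" "D \<in> carrier (torsion_group (B n))"
        "torsion_iso n C = torsion_iso n D"
      then obtain p q where pq: "p \<in> torsion_reps n" "q \<in> torsion_reps n" "C = residue n p" "D = residue n q"
        by (auto simp: torsion_group_def torsion_B)
      with CD(3) show "C = D"
        by (simp only: torsion_iso_residue class_family_to_form_eq_iff)
    qed
    show "torsion_iso n ` carrier (torsion_group (B n)) = carrier (H_ev_plus n)"
    proof (intro equalityI subsetI)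
      fix h assume "h \<in> torsion_iso n ` carrier (torsion_group (B n))"
      then show "h \<in> carrier (H_ev_plus n)"
        by (auto simp: torsion_group_def torsion_B torsion_iso_residue class_family_in_carrier)
    next
      fix h assume h: "h \<in> carrier (H_ev_plus n)"
      then have "\<forall>k\<in>{1..n div 2}. \<exists>\<omega>\<in>closed_forms n (2 * k). h k = cohomology_class n (2 * k) \<omega>"
        unfolding carrier_H_ev_plus by (auto dest!: PiE_mem)
      then obtain \<omega> where \<omega>: "\<And>k. k \<in> {1..n div 2} \<Longrightarrow> \<omega> k \<in> closed_forms n (2 * k)"
        "\<And>k. k \<in> {1..n div 2} \<Longrightarrow> h k = cohomology_class n (2 * k) (\<omega> k)"
        by metis
      let ?p = "from_form n (\<Sum>k\<in>{1..n div 2}. \<omega> k)"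
      have "\<forall>k\<in>{1..n div 2}. \<omega> k \<in> closed_forms n (2 * k)"
        using \<omega>(1) by blast
      note realised = class_family_realised[OF this]
      have "h = (\<lambda>k\<in>{1..n div 2}. h k)"
        using h unfolding carrier_H_ev_plus by (simp add: PiE_def extensional_restrict)
      also have "\<dots> = torsion_iso n (residue n ?p)"
        unfolding torsion_iso_residue[OF realised(1)] realised(2)
        by (intro restrict_ext \<omega>(2))
      finally show "h \<in> torsion_iso n ` carrier (torsion_group (B n))"
        using realised(1) by (auto simp: torsion_group_def torsion_B)
    qed
  qed
qed

lemma torsion_iso_graded:
  "torsion_iso n ` (torsion (B n) \<inter> B1bar_component n m) = H_ev_plus_component n m"
proof (intro equalityI subsetI)
  fix h assume "h \<in> torsion_iso n ` (torsion (B n) \<inter> B1bar_component n m)"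
  then obtain p where p: "p \<in> free_ring_component n m" "residue n p \<in> torsion (B n)" "h = torsion_iso n (residue n p)"
    by (auto simp: B1bar_component_eq)
  then have c: "p \<in> free_carrier n" by (simp add: free_ring_component_eq)
  with p(2) have rep: "p \<in> torsion_reps n" by (simp add: residue_torsion_iff)
  have "degree_part (2 * k) (to_form p) \<in> closed_forms n (2 * k) \<inter> form_component m" for k
    using degree_part_closed[OF rep] degree_part_component[OF to_form_component[OF p(1)]] by blast
  then show "h \<in> H_ev_plus_component n m"
    using class_family_in_carrier[OF rep]
    by (auto simp: H_ev_plus_component_def p(3) torsion_iso_residue[OF rep] cohomology_component_eq class_family_def)
next
  fix h assume "h \<in> H_ev_plus_component n m"
  then have h: "h \<in> carrier (H_ev_plus n)"
    "\<forall>k\<in>{1..n div 2}. \<exists>\<omega>\<in>closed_forms n (2 * k) \<inter> form_component m. h k = cohomology_class n (2 * k) \<omega>"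
    unfolding H_ev_plus_component_def cohomology_component_eq by auto
  then obtain \<omega> where \<omega>: "\<And>k. k \<in> {1..n div 2} \<Longrightarrow> \<omega> k \<in> closed_forms n (2 * k)"
    "\<And>k. k \<in> {1..n div 2} \<Longrightarrow> \<omega> k \<in> form_component m"
    "\<And>k. k \<in> {1..n div 2} \<Longrightarrow> h k = cohomology_class n (2 * k) (\<omega> k)"
    by (metis IntD1 IntD2)
  let ?\<eta> = "\<Sum>k\<in>{1..n div 2}. \<omega> k"
  have "\<forall>k\<in>{1..n div 2}. \<omega> k \<in> closed_forms n (2 * k)"
    using \<omega>(1) by blast
  note realised = class_family_realised[OF this]
  have "?\<eta> \<in> even_forms n"
  proof (rule forms_in_sum)
    fix k assume "k \<in> {1..n div 2}"
    then have "\<omega> k \<in> forms_in n {2 * k}" using \<omega>(1) by (simp add: closed_forms_eq)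
    moreover have "forms_in n {2 * k} \<subseteq> even_forms n" by (rule forms_in_subset) auto
    ultimately show "\<omega> k \<in> even_forms n" by blast
  qed
  then have "from_form n ?\<eta> \<in> free_ring_component n m"
    by (rule from_form_component) (intro form_component_sum \<omega>(2))
  moreover have "residue n (from_form n ?\<eta>) \<in> torsion (B n)"
    using realised(1) by (auto simp: torsion_B)
  moreover have "h = (\<lambda>k\<in>{1..n div 2}. h k)"
    using h(1) unfolding carrier_H_ev_plus by (simp add: PiE_def extensional_restrict)
  moreover have "(\<lambda>k\<in>{1..n div 2}. h k) = torsion_iso n (residue n (from_form n ?\<eta>))"
    unfolding torsion_iso_residue[OF realised(1)] realised(2)
    by (intro restrict_ext \<omega>(3))
  ultimately show "h \<in> torsion_iso n ` (torsion (B n) \<inter> B1bar_component n m)"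
    unfolding B1bar_component_eq by (intro image_eqI[of _ _ "residue n (from_form n ?\<eta>)"]) auto
qed

theorem theorem3p8:
  fixes n :: nat
  assumes "n \<ge> 1"
  shows "\<exists>\<phi>. \<phi> \<in> iso (torsion_group (B1bar (free_ring n))) (H_ev_plus n) \<and>
             (\<forall>m \<in> multidegrees n.
                \<phi> ` (torsion (B1bar (free_ring n)) \<inter> B1bar_component n m) = H_ev_plus_component n m)"
  using torsion_iso_iso torsion_iso_graded by blast


end
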